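(* Let $(X,\varphi,\mathbb{Z}^d)$, $(Y,\psi,\mathbb{Z}^d)$ and $(Z,\alpha,\mathbb{Z}^d)$ be free minimal Cantor systems. Suppose there exist bounded orbit injections $\theta_1$ from $(X,\varphi,\mathbb{Z}^d)$ into $(Z,\alpha,\mathbb{Z}^d)$ and $\theta_2$ from $(Y,\psi,\mathbb{Z}^d)$ into $(Z,\alpha,\mathbb{Z}^d)$, and that $h_{\theta_1}[1_X]<h_{\theta_2}[1_Y]$ in $G(\alpha)$. Then there is a bounded orbit injection from $(X,\varphi,\mathbb{Z}^d)$ into $(Y,\psi,\mathbb{Z}^d)$.
   Context: $d$ is a positive integer. A dynamical system $(X,\varphi,\mathbb{Z}^d)$ is a compact space $X$ with an action $\varphi$ of $\mathbb{Z}^d$ by homeomorphisms $\varphi^z$. It is a Cantor system if $X$ is a Cantor set, free if the action is free, and minimal if every orbit is dense. Orbit injection: for free dynamical systems $(X,\varphi,\mathbb{Z}^d)$ and $(Y,\psi,\mathbb{Z}^d)$, a map $\theta:X\to Y$ is an orbit injection if it is a continuous open injection such that for all $x,y\in X$: there is $w\in\mathbb{Z}^d$ with $\varphi^w(x)=y$ if and only if there is $v\in\mathbb{Z}^d$ with $\psi^v(\theta(x))=\theta(y)$. Its cocycle is the (unique) function $\eta:X\times\mathbb{Z}^d\to\mathbb{Z}^d$ with $\psi^{\eta(x,w)}(\theta(x))=\theta(\varphi^w(x))$. The orbit injection is bounded if $\eta$ is continuous. Ordered group: $G(\varphi)=C(X,\mathbb{Z})/B(\varphi)$, where $B(\varphi)$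 is the subgroup of $C(X,\mathbb{Z})$ generated by the functions $1_A-1_{\varphi^vA}$ with $A\subseteq X$ clopen and $v\in\mathbb{Z}^d$; and $G(\varphi)_+=\{[f]: f\in C(X,\mathbb{Z}),\ f\ge 0\}$. For $g_1,g_2\in G(\varphi)$, $g_2\ge g_1$ means $g_2-g_1\in G(\varphi)_+$, and $g_2>g_1$ means $g_2\ge g_1$ and $g_2\ne g_1$. For a bounded orbit injection $\theta$ from $(X,\varphi,\mathbb{Z}^d)$ to $(Z,\alpha,\mathbb{Z}^d)$, $h_\theta:G(\varphi)\to G(\alpha)$ denotes the (well-defined) ordered group isomorphism determined by $h_\theta[1_A]=[1_{\theta(A)}]$ for clopen $A\subseteq X$. *)

theory Defs
  imports "HOL-Analysis.Analysis" "HOL-Algebra.Generated_Groups"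
begin

text \<open>
  Spaces are topologies on arbitrary carriers, and the group \<open>\<int>\<^sup>d\<close> is the additive group of the
  type \<open>int ^ 'd\<close> with \<open>'d\<close> a finite type of cardinality \<open>d \<ge> 1\<close>.  An action is a curried function
  \<open>\<phi>\<close>, with \<open>\<phi> z\<close> the homeomorphism given by \<open>z\<close>.
\<close>

definition cantor_space :: "'a topology \<Rightarrow> bool" where
  "cantor_space X \<longleftrightarrow>
     X homeomorphic_space product_topology (\<lambda>_::nat. discrete_topology (UNIV :: bool set)) UNIV"

definition dynamical_system :: "'a topology \<Rightarrow> (int ^ 'd \<Rightarrow> 'a \<Rightarrow> 'a) \<Rightarrow> bool" where
  "dynamical_system X \<phi> \<longleftrightarrow>
     compact_space X \<and>
     (\<forall>z. homeomorphic_map X X (\<phi> z)) \<and>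
     (\<forall>x \<in> topspace X. \<phi> 0 x = x) \<and>
     (\<forall>z w. \<forall>x \<in> topspace X. \<phi> (z + w) x = \<phi> z (\<phi> w x))"

definition free_action :: "'a topology \<Rightarrow> (int ^ 'd \<Rightarrow> 'a \<Rightarrow> 'a) \<Rightarrow> bool" where
  "free_action X \<phi> \<longleftrightarrow> (\<forall>z. \<forall>x \<in> topspace X. \<phi> z x = x \<longrightarrow> z = 0)"

definition minimal_action :: "'a topology \<Rightarrow> (int ^ 'd \<Rightarrow> 'a \<Rightarrow> 'a) \<Rightarrow> bool" where
  "minimal_action X \<phi> \<longleftrightarrow> (\<forall>x \<in> topspace X. X closure_of (range (\<lambda>z. \<phi> z x)) = topspace X)"

definition free_minimal_cantor_system :: "'a topology \<Rightarrow> (int ^ 'd \<Rightarrow> 'a \<Rightarrow> 'a) \<Rightarrow> bool" where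
  "free_minimal_cantor_system X \<phi> \<longleftrightarrow>
     dynamical_system X \<phi> \<and> cantor_space X \<and> free_action X \<phi> \<and> minimal_action X \<phi>"

definition orbit_injection ::
  "'a topology \<Rightarrow> (int ^ 'd \<Rightarrow> 'a \<Rightarrow> 'a) \<Rightarrow> 'b topology \<Rightarrow> (int ^ 'd \<Rightarrow> 'b \<Rightarrow> 'b) \<Rightarrow> ('a \<Rightarrow> 'b) \<Rightarrow> bool"
  where
  "orbit_injection X \<phi> Y \<psi> \<theta> \<longleftrightarrow>
     continuous_map X Y \<theta> \<and> open_map X Y \<theta> \<and> inj_on \<theta> (topspace X) \<and>
     (\<forall>x \<in> topspace X. \<forall>y \<in> topspace X.
        (\<exists>w. \<phi> w x = y) \<longleftrightarrow> (\<exists>v. \<psi> v (\<theta> x) = \<theta> y))"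

text \<open>The description below is unique because the target action is free.\<close>

definition cocycle ::
  "(int ^ 'd \<Rightarrow> 'a \<Rightarrow> 'a) \<Rightarrow> (int ^ 'd \<Rightarrow> 'b \<Rightarrow> 'b) \<Rightarrow> ('a \<Rightarrow> 'b) \<Rightarrow> 'a \<Rightarrow> int ^ 'd \<Rightarrow> int ^ 'd"
  where
  "cocycle \<phi> \<psi> \<theta> x w = (THE v. \<psi> v (\<theta> x) = \<theta> (\<phi> w x))"

definition bounded_orbit_injection ::
  "'a topology \<Rightarrow> (int ^ 'd \<Rightarrow> 'a \<Rightarrow> 'a) \<Rightarrow> 'b topology \<Rightarrow> (int ^ 'd \<Rightarrow> 'b \<Rightarrow> 'b) \<Rightarrow> ('a \<Rightarrow> 'b) \<Rightarrow> bool"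
  where
  "bounded_orbit_injection X \<phi> Y \<psi> \<theta> \<longleftrightarrow>
     orbit_injection X \<phi> Y \<psi> \<theta> \<and>
     continuous_map (prod_topology X (discrete_topology UNIV)) (discrete_topology UNIV)
       (\<lambda>(x, w). cocycle \<phi> \<psi> \<theta> x w)"

definition clopenin :: "'a topology \<Rightarrow> 'a set \<Rightarrow> bool" where
  "clopenin X A \<longleftrightarrow> openin X A \<and> closedin X A"

text \<open>
  The group \<open>C(X, \<int>)\<close> under pointwise addition, as a group record; functions on \<open>X\<close> are
  represented by functions that are \<open>undefined\<close> off the carrier of \<open>X\<close>.
\<close>

definition CZ :: "'a topology \<Rightarrow> ('a \<Rightarrow> int) monoid" where
  "CZ X =
     \<lparr>carrier = {f \<in> extensional (topspace X). continuous_map X (discrete_topology UNIV) f},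
      monoid.mult = (\<lambda>f g. \<lambda>x \<in> topspace X. f x + g x),
      one = (\<lambda>x \<in> topspace X. 0)\<rparr>"

definition ind :: "'a topology \<Rightarrow> 'a set \<Rightarrow> 'a \<Rightarrow> int" where
  "ind X A = (\<lambda>x \<in> topspace X. indicator A x)"

definition coboundaries :: "'a topology \<Rightarrow> (int ^ 'd \<Rightarrow> 'a \<Rightarrow> 'a) \<Rightarrow> ('a \<Rightarrow> int) set" where
  "coboundaries X \<phi> =
     generate (CZ X) {(\<lambda>x \<in> topspace X. ind X A x - ind X (\<phi> v ` A) x) | A v. clopenin X A}"

definition GZ :: "'a topology \<Rightarrow> (int ^ 'd \<Rightarrow> 'a \<Rightarrow> 'a) \<Rightarrow> ('a \<Rightarrow> int) set monoid" where
  "GZ X \<phi> = CZ X Mod coboundaries X \<phi>"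

definition cls :: "'a topology \<Rightarrow> (int ^ 'd \<Rightarrow> 'a \<Rightarrow> 'a) \<Rightarrow> ('a \<Rightarrow> int) \<Rightarrow> ('a \<Rightarrow> int) set" where
  "cls X \<phi> f = coboundaries X \<phi> #>\<^bsub>CZ X\<^esub> f"

definition GZ_pos :: "'a topology \<Rightarrow> (int ^ 'd \<Rightarrow> 'a \<Rightarrow> 'a) \<Rightarrow> ('a \<Rightarrow> int) set set" where
  "GZ_pos X \<phi> = {cls X \<phi> f | f. f \<in> carrier (CZ X) \<and> (\<forall>x \<in> topspace X. 0 \<le> f x)}"

definition GZ_le ::
  "'a topology \<Rightarrow> (int ^ 'd \<Rightarrow> 'a \<Rightarrow> 'a) \<Rightarrow> ('a \<Rightarrow> int) set \<Rightarrow> ('a \<Rightarrow> int) set \<Rightarrow> bool" where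
  "GZ_le X \<phi> g1 g2 \<longleftrightarrow> g2 \<otimes>\<^bsub>GZ X \<phi>\<^esub> inv\<^bsub>GZ X \<phi>\<^esub> g1 \<in> GZ_pos X \<phi>"

definition GZ_less ::
  "'a topology \<Rightarrow> (int ^ 'd \<Rightarrow> 'a \<Rightarrow> 'a) \<Rightarrow> ('a \<Rightarrow> int) set \<Rightarrow> ('a \<Rightarrow> int) set \<Rightarrow> bool" where
  "GZ_less X \<phi> g1 g2 \<longleftrightarrow> GZ_le X \<phi> g1 g2 \<and> g2 \<noteq> g1"

text \<open>
  The map \<open>h\<^sub>\<theta>\<close>.  The classes \<open>[1\<^sub>A]\<close> generate the group, so at most one homomorphism takes the
  prescribed values; that one exists, and is an isomorphism of ordered groups, is a property of
  bounded orbit injections between free minimal Cantor systems.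
\<close>

definition induced_hom ::
  "'a topology \<Rightarrow> (int ^ 'd \<Rightarrow> 'a \<Rightarrow> 'a) \<Rightarrow> 'b topology \<Rightarrow> (int ^ 'd \<Rightarrow> 'b \<Rightarrow> 'b) \<Rightarrow> ('a \<Rightarrow> 'b)
     \<Rightarrow> ('a \<Rightarrow> int) set \<Rightarrow> ('b \<Rightarrow> int) set"
  where
  "induced_hom X \<phi> Z \<alpha> \<theta> =
     (THE h. h \<in> hom (GZ X \<phi>) (GZ Z \<alpha>) \<and> h \<in> extensional (carrier (GZ X \<phi>)) \<and>
        (\<forall>A. clopenin X A \<longrightarrow> h (cls X \<phi> (ind X A)) = cls Z \<alpha> (ind Z (\<theta> ` A))))"

end

theory Submission imports Defs begin

text \<open>
  Let \<open>A\<close> and \<open>B\<close> be the images of \<open>X\<close> and \<open>Y\<close> in \<open>Z\<close>, so that \<open>[1\<^sub>A] < [1\<^sub>B]\<close>.  Then \<open>1\<^sub>B - 1\<^sub>A\<close> is the sum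
  of a nonzero nonnegative function \<open>g\<close> and a coboundary.  Over a cube of side \<open>n\<close> in an orbit the
  coboundary sums to \<open>o(n\<^sup>d)\<close>, whereas by minimality \<open>g\<close> sums to at least \<open>c n\<^sup>d\<close>; hence for some \<open>n\<close> every
  cube of side \<open>n\<close> contains more points of \<open>B\<close> than of \<open>A\<close>.

  Cutting an orbit into cubes of side \<open>n\<close> shows that the bipartite graph joining a point of \<open>A\<close> to the
  points of \<open>B\<close> at distance at most \<open>n\<close> is expanding: \<open>(1 + n\<^sup>-\<^sup>d) |S| \<le> |N(S)|\<close> for finite \<open>S\<close>.
  Balls in \<open>\<int>\<^sup>d\<close> grow polynomially, so for any partial matching an augmenting path of bounded length starts
  at every unmatched point of \<open>A\<close>.  Cover \<open>Z\<close> by finitely many clopen sets whose returns are far apart and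
  augment along all points of one of these sets at a time: the augmentations do not interfere, and after
  finitely many steps all of \<open>A\<close> is matched by an injection \<open>A \<rightarrow> B\<close> that moves points along orbits by
  a locally constant vector.  Composing it with \<open>\<theta>1\<close> and the inverse of \<open>\<theta>2\<close> gives the map.
\<close>

section \<open>Augmenting matchings in an expanding graph on the integer lattice\<close>

definition ball0 :: "nat \<Rightarrow> (int ^ 'd) set" where
  "ball0 k = {v. \<forall>i. \<bar>v $ i\<bar> \<le> int k}"

text \<open>Half-open, so that the translates by multiples of \<open>n\<close> tile the lattice
  without overlap.\<close>

definition cube :: "nat \<Rightarrow> int ^ 'd \<Rightarrow> (int ^ 'd) set" where
  "cube n u = {v. \<forall>i. u $ i \<le> v $ i \<and> v $ i < u $ i + int n}"

lemma card_vec_Pi: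
  fixes S :: "'d::finite \<Rightarrow> int set"
  assumes "\<And>i. finite (S i)"
  shows "finite {v :: int ^ 'd. \<forall>i. v $ i \<in> S i}"
    and "card {v :: int ^ 'd. \<forall>i. v $ i \<in> S i} = (\<Prod>i\<in>UNIV. card (S i))"
proof -
  have eq: "{v :: int ^ 'd. \<forall>i. v $ i \<in> S i} = vec_lambda ` (PiE UNIV S)"
  proof
    show "{v :: int ^ 'd. \<forall>i. v $ i \<in> S i} \<subseteq> vec_lambda ` (PiE UNIV S)"
    proof
      fix v :: "int ^ 'd" assume "v \<in> {v. \<forall>i. v $ i \<in> S i}"
      then have "vec_nth v \<in> PiE UNIV S" by auto
      then show "v \<in> vec_lambda ` (PiE UNIV S)" by (metis imageI vec_nth_inverse)
    qed
  qed auto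
  have inj: "inj_on (vec_lambda :: _ \<Rightarrow> int ^ 'd) (PiE UNIV S)"
    by (simp add: inj_on_def vec_lambda_inject)
  show "finite {v :: int ^ 'd. \<forall>i. v $ i \<in> S i}"
    unfolding eq by (intro finite_imageI finite_PiE) (auto simp: assms)
  show "card {v :: int ^ 'd. \<forall>i. v $ i \<in> S i} = (\<Prod>i\<in>UNIV. card (S i))"
    unfolding eq by (simp add: card_image[OF inj] card_PiE)
qed

lemma finite_cube [simp]: "finite (cube n u)" and card_cube: "card (cube n (u :: int ^ 'd)) = n ^ CARD('d)"
proof -
  have eq: "cube n u = {v. \<forall>i. v $ i \<in> {u $ i ..< u $ i + int n}}"
    by (auto simp: cube_def)
  show "finite (cube n u)" unfolding eq by (rule card_vec_Pi) simp
  show "card (cube n u) = n ^ CARD('d)" unfolding eq by (subst card_vec_Pi) simp_all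
qed

lemma finite_ball0 [simp]: "finite (ball0 k :: (int ^ 'd) set)"
  and card_ball0: "card (ball0 k :: (int ^ 'd) set) = (2 * k + 1) ^ CARD('d)"
proof -
  have eq: "ball0 k = {v :: int ^ 'd. \<forall>i. v $ i \<in> {- int k .. int k}}"
    by (auto simp: ball0_def abs_le_iff) (metis minus_le_iff)+
  show "finite (ball0 k :: (int ^ 'd) set)" unfolding eq by (rule card_vec_Pi) simp
  have "nat (1 + int k + int k) = 2 * k + 1" by simp
  then show "card (ball0 k :: (int ^ 'd) set) = (2 * k + 1) ^ CARD('d)"
    unfolding eq by (subst card_vec_Pi) (simp_all add: algebra_simps)
qed

lemma zero_ball0 [simp]: "0 \<in> ball0 k"
  by (simp add: ball0_def)

lemma ball0_mono: "v \<in> ball0 k \<Longrightarrow> k \<le> l \<Longrightarrow> v \<in> ball0 l"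
  unfolding ball0_def by (simp, meson of_nat_le_iff order_trans)

lemma ball0_minus [simp]: "- v \<in> ball0 k \<longleftrightarrow> v \<in> ball0 k"
  by (simp add: ball0_def)

lemma ball0_add: "v \<in> ball0 k \<Longrightarrow> w \<in> ball0 l \<Longrightarrow> v + w \<in> ball0 (k + l)"
  unfolding ball0_def by (simp, meson abs_triangle_ineq add_mono order_trans)

lemma ball0_diff: "v \<in> ball0 k \<Longrightarrow> w \<in> ball0 l \<Longrightarrow> v - w \<in> ball0 (k + l)"
  using ball0_add[of v k "- w" l] by simp

lemma cube_diff_ball0: "v \<in> cube n u \<Longrightarrow> w \<in> cube n u \<Longrightarrow> v - w \<in> ball0 n"
  unfolding cube_def ball0_def by (simp add: abs_le_iff) (smt (verit))

text \<open>Division with remainder in every coordinate: a point lies in exactly one cell of the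
  grid of side \<open>n\<close>, the one indexed by its quotients. Disjointness of the cells and the
  fact that they cover everything both come from here.\<close>

lemma mem_grid_cube:
  assumes "n > 0"
  shows "v \<in> cube n (\<chi> i. int n * u $ i) \<longleftrightarrow> (\<chi> i. v $ i div int n) = u"
proof -
  have "int n * k \<le> x \<and> x < int n * k + int n \<longleftrightarrow> x div int n = k" for x k :: int
    using assms by (auto simp: div_int_pos_iff intro!: int_div_pos_eq[of _ _ _ "x - int n * k"])
      (metis mult.commute assms of_nat_0_less_iff pos_mod_bound pos_mod_sign div_mult_mod_eq
         add_increasing2 order.refl add_less_cancel_left)+
  then show ?thesis by (auto simp: cube_def vec_eq_iff)
qed

text \<open>The neighbourhood of \<open>S\<close> in the bipartite graph whose edges join points at
  distance at most \<open>n\<close> in the maximum norm.\<close>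

definition nbrs :: "(int ^ 'd) set \<Rightarrow> nat \<Rightarrow> (int ^ 'd) set \<Rightarrow> (int ^ 'd) set" where
  "nbrs b n S = {w \<in> b. \<exists>s\<in>S. w - s \<in> ball0 n}"

lemma finite_nbrs:
  assumes "finite S" shows "finite (nbrs b n S)"
proof (rule finite_subset)
  show "nbrs b n S \<subseteq> (\<Union>s\<in>S. (+) s ` ball0 n)"
    unfolding nbrs_def by (auto simp: image_iff) (metis add.commute diff_add_cancel)
  show "finite (\<Union>s\<in>S. (+) s ` ball0 n)" using assms finite_ball0 by blast
qed

lemma nbrs_mono: "S \<subseteq> T \<Longrightarrow> nbrs b n S \<subseteq> nbrs b n T"
  by (auto simp: nbrs_def)

text \<open>Each cell of the grid of side \<open>n\<close> meeting \<open>S\<close> contributes at least one more point of \<open>b\<close>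
  than of \<open>a\<close>.\<close>

lemma nbrs_expansion:
  fixes a b S :: "(int ^ 'd) set"
  assumes cnt: "\<And>u. card (a \<inter> cube n u) < card (b \<inter> cube n u)"
    and S: "finite S" "S \<subseteq> a"
  shows "(n ^ CARD('d) + 1) * card S \<le> n ^ CARD('d) * card (nbrs b n S)"
proof -
  have n: "n > 0"
  proof (rule ccontr)
    assume "\<not> n > 0"
    then have "cube n (0 :: int ^ 'd) = {}" by (auto simp: cube_def)
    then show False using cnt[of 0] by simp
  qed
  define p where "p v = (\<chi> i. v $ i div int n)" for v :: "int ^ 'd"
  define Q where "Q u = cube n (\<chi> i. int n * u $ i)" for u :: "int ^ 'd"
  have Q: "v \<in> Q u \<longleftrightarrow> p v = u" for u v
    using mem_grid_cube[OF n] by (simp add: Q_def p_def)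
  have dj: "disjoint_family_on (\<lambda>u. X \<inter> Q u) I" for X I
    by (auto simp: disjoint_family_on_def Q)
  let ?I = "p ` S" and ?q = "n ^ CARD('d)"
  have finQ: "finite (X \<inter> Q u)" for X u by (simp add: Q_def finite_cube)
  have "card S \<le> card (\<Union>u\<in>?I. a \<inter> Q u)"
    using S by (intro card_mono finite_UN_I finQ) (auto simp: Q)
  also have "\<dots> = (\<Sum>u\<in>?I. card (a \<inter> Q u))"
    using S finQ by (intro card_UN_disjoint) (auto simp: Q)
  finally have 1: "card S \<le> (\<Sum>u\<in>?I. card (a \<inter> Q u))" .
  have "(\<Sum>u\<in>?I. card (b \<inter> Q u)) = card (\<Union>u\<in>?I. b \<inter> Q u)"
    using S finQ by (intro card_UN_disjoint[symmetric]) (auto simp: Q)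
  also have "\<dots> \<le> card (nbrs b n S)"
  proof (intro card_mono finite_nbrs S subsetI)
    fix w assume "w \<in> (\<Union>u\<in>?I. b \<inter> Q u)"
    then obtain s where "s \<in> S" "w \<in> b" "w \<in> Q (p s)" by blast
    moreover have "s \<in> Q (p s)" by (simp add: Q)
    ultimately show "w \<in> nbrs b n S"
      using cube_diff_ball0 unfolding Q_def nbrs_def by blast
  qed
  finally have 2: "(\<Sum>u\<in>?I. card (b \<inter> Q u)) \<le> card (nbrs b n S)" .
  have "(?q + 1) * card S \<le> (\<Sum>u\<in>?I. (?q + 1) * card (a \<inter> Q u))"
    using 1 by (metis mult_le_mono2 sum_distrib_left)
  also have "\<dots> \<le> (\<Sum>u\<in>?I. ?q * card (b \<inter> Q u))"
  proof (rule sum_mono)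
    fix u
    \<comment> \<open>A surplus of one point over at most \<open>?q\<close> points of
      \<open>a\<close> is a gain by the factor 1 + 1/\<open>?q\<close> in each cell, and a uniform
      factor survives summation over the cells.\<close>
    have "card (a \<inter> Q u) \<le> ?q"
      using card_mono[of "Q u" "a \<inter> Q u"] by (simp add: Q_def finite_cube card_cube)
    moreover have "card (a \<inter> Q u) + 1 \<le> card (b \<inter> Q u)"
      using cnt by (simp add: Q_def Suc_le_eq)
    then have "?q * (card (a \<inter> Q u) + 1) \<le> ?q * card (b \<inter> Q u)" by (rule mult_le_mono2)
    ultimately show "(?q + 1) * card (a \<inter> Q u) \<le> ?q * card (b \<inter> Q u)"
      by (simp add: algebra_simps)
  qed
  also have "\<dots> \<le> ?q * card (nbrs b n S)"
    using 2 by (metis mult_le_mono2 sum_distrib_left)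
  finally show ?thesis .
qed

section \<open>Alternating paths and augmentation of matchings\<close>

definition matching ::
  "(int ^ 'd) set \<Rightarrow> (int ^ 'd) set \<Rightarrow> nat \<Rightarrow> (int ^ 'd \<Rightarrow> (int ^ 'd) option) \<Rightarrow> bool" where
  "matching a b n m \<longleftrightarrow>
     (\<forall>v w. m v = Some w \<longrightarrow> v \<in> a \<and> w \<in> b \<and> w - v \<in> ball0 n) \<and> inj_on m (dom m)"

text \<open>The points at which alternating paths from \<open>x\<close> with at most
  \<open>k\<close> rounds end; a round follows an edge to some \<open>w\<close> and returns along
  the matched edge at \<open>w\<close>.\<close>

primrec reach ::
  "(int ^ 'd) set \<Rightarrow> nat \<Rightarrow> (int ^ 'd \<Rightarrow> (int ^ 'd) option) \<Rightarrow> int ^ 'd \<Rightarrow> nat \<Rightarrow> (int ^ 'd) set"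
where
  "reach b n m x 0 = {x}"
| "reach b n m x (Suc k) =
     reach b n m x k \<union> {v. \<exists>w \<in> nbrs b n (reach b n m x k). m v = Some w}"

text \<open>Each round moves by at most \<open>n\<close> to \<open>w\<close> and by at most
  \<open>n\<close> back along the matched edge.\<close>

lemma reach_ball:
  assumes "matching a b n m" "v \<in> reach b n m x k"
  shows "v - x \<in> ball0 (2 * n * k)"
  using assms(2)
proof (induction k arbitrary: v)
  case (Suc k)
  consider "v \<in> reach b n m x k" | w where "w \<in> nbrs b n (reach b n m x k)" "m v = Some w"
    using Suc.prems by auto
  then show ?case
  proof cases
    case 1
    then show ?thesis using Suc.IH ball0_mono by fastforce
  next
    case 2
    then obtain s where s: "s \<in> reach b n m x k" "w - s \<in> ball0 n" by (auto simp: nbrs_def)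
    have "w - v \<in> ball0 n" using assms(1) 2 by (auto simp: matching_def)
    then have "((w - s) - (w - v)) + (s - x) \<in> ball0 ((n + n) + 2 * n * k)"
      using s Suc.IH by (intro ball0_add ball0_diff)
    then show ?thesis by (simp add: algebra_simps)
  qed
qed simp

lemma reach_subset:
  assumes "matching a b n m" "x \<in> a"
  shows "reach b n m x k \<subseteq> a"
  using assms by (induction k) (auto simp: matching_def)

text \<open>Everything reached lies in a ball about \<open>x\<close> whose radius is linear in
  \<open>k\<close>. This polynomial bound is what exponential expansion will contradict.\<close>

lemma finite_reach:
  assumes "matching a b n m"
  shows "finite (reach b n m x k)"
    and "card (reach b n m x k :: (int ^ 'd) set) \<le> (4 * n * k + 1) ^ CARD('d)"
proof -
  have sub: "reach b n m x k \<subseteq> (+) x ` ball0 (2 * n * k)"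
  proof
    fix v assume "v \<in> reach b n m x k"
    then have "v - x \<in> ball0 (2 * n * k)" using reach_ball[OF assms] by blast
    then show "v \<in> (+) x ` ball0 (2 * n * k)" by (auto simp: image_iff intro: bexI[of _ "v - x"])
  qed
  then show "finite (reach b n m x k)" using finite_ball0 finite_surj by blast
  show "card (reach b n m x k) \<le> (4 * n * k + 1) ^ CARD('d)"
    using card_mono[OF finite_imageI[OF finite_ball0] sub] card_ball0[where 'd='d, of "2 * n * k"]
    by (simp add: card_image mult.assoc)
qed

text \<open>An alternating path consults the matching only at the points it visits, so a change
  elsewhere leaves it intact. The change may create further paths, hence only an inclusion.\<close>

lemma reach_cong:
  assumes "\<And>v. v \<in> reach b n m x k \<Longrightarrow> m' v = m v"
  shows "reach b n m x k \<subseteq> reach b n m' x k"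
  using assms
proof (induction k)
  case (Suc k)
  then have IH: "reach b n m x k \<subseteq> reach b n m' x k" by simp
  show ?case
  proof
    fix v assume v: "v \<in> reach b n m x (Suc k)"
    consider "v \<in> reach b n m x k" | w where "w \<in> nbrs b n (reach b n m x k)" "m v = Some w"
      using v by auto
    then show "v \<in> reach b n m' x (Suc k)"
    proof cases
      case 1
      then show ?thesis using IH by auto
    next
      case 2
      then have "m' v = Some w" "w \<in> nbrs b n (reach b n m' x k)"
        using Suc.prems[OF v] nbrs_mono[OF IH] by auto
      then show ?thesis by auto
    qed
  qed
qed simp

text \<open>The point \<open>s\<close> may be matched already; its former partner is then released,
  which is the elementary move of an augmentation.\<close>

lemma matching_update:
  assumes "matching a b n m" "s \<in> a" "w \<in> b" "w - s \<in> ball0 n" "w \<notin> ran m"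
  shows "matching a b n (m(s \<mapsto> w))"
  using assms unfolding matching_def inj_on_def ran_def dom_def by (auto split: if_splits)

text \<open>The path is flipped from its free end. Its last point \<open>s\<close> is rematched to
  the free \<open>w\<close>; the former partner of \<open>s\<close> becomes free and is adjacent to
  a point reached one round earlier, so induction on \<open>k\<close> ends by matching
  \<open>x\<close> itself. Only points on the path change, whence the distance bound.\<close>

lemma augment:
  assumes "matching a b n m" "x \<in> a" "w \<in> nbrs b n (reach b n m x k)" "w \<notin> ran m"
  shows "\<exists>m'. matching a b n m' \<and> dom m' = insert x (dom m) \<and>
           (\<forall>v. v - x \<notin> ball0 (2 * n * k) \<longrightarrow> m' v = m v)"
  using assms
proof (induction k arbitrary: m w)
  case 0
  then have "matching a b n (m(x \<mapsto> w))"
    by (intro matching_update) (auto simp: nbrs_def)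
  then show ?case by (intro exI[of _ "m(x \<mapsto> w)"]) (auto simp del: fun_upd_apply, auto)
next
  case (Suc k)
  from Suc.prems(3) obtain s where s: "s \<in> reach b n m x (Suc k)" "w \<in> b" "w - s \<in> ball0 n"
    by (auto simp: nbrs_def)
  show ?case
  proof (cases "s \<in> reach b n m x k")
    case True
    then have "w \<in> nbrs b n (reach b n m x k)" using s by (auto simp: nbrs_def)
    from Suc.IH[OF Suc.prems(1,2) this Suc.prems(4)] show ?thesis
      using ball0_mono by (metis le_SucI mult_le_mono2 order_refl)
  next
    case False
    then obtain w0 where w0: "w0 \<in> nbrs b n (reach b n m x k)" "m s = Some w0"
      using s by auto
    define m1 where "m1 = m(s \<mapsto> w)"
    have m1: "matching a b n m1"
      unfolding m1_def
      using Suc.prems s subsetD[OF reach_subset[OF Suc.prems(1,2)] s(1)] by (intro matching_update) auto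
    \<comment> \<open>The rematched point \<open>s\<close> is not reached within \<open>k\<close>
      rounds, so the shorter paths survive.\<close>
    have "reach b n m x k \<subseteq> reach b n m1 x k"
      using False by (intro reach_cong) (auto simp: m1_def)
    then have "w0 \<in> nbrs b n (reach b n m1 x k)" using w0 nbrs_mono by blast
    moreover have "w0 \<notin> ran m1"
    proof
      assume "w0 \<in> ran m1"
      then obtain v where v: "m1 v = Some w0" by (auto simp: ran_def)
      have "w \<noteq> w0" using w0 Suc.prems(4) by (auto simp: ran_def)
      with v have "v \<noteq> s" "m v = Some w0" by (auto simp: m1_def split: if_splits)
      then show False using w0 Suc.prems(1) by (auto simp: matching_def inj_on_def dom_def)
    qed
    ultimately obtain m' where m': "matching a b n m'" "dom m' = insert x (dom m1)"
      "\<And>v. v - x \<notin> ball0 (2 * n * k) \<Longrightarrow> m' v = m1 v"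
      using Suc.IH[OF m1 Suc.prems(2)] by metis
    have "dom m1 = dom m" using w0 by (auto simp: m1_def)
    moreover have "m' v = m v" if "v - x \<notin> ball0 (2 * n * Suc k)" for v
    proof -
      have "v \<noteq> s" using that s reach_ball[OF Suc.prems(1)] by blast
      moreover have "v - x \<notin> ball0 (2 * n * k)"
        using that ball0_mono by (metis le_SucI mult_le_mono2 order_refl)
      ultimately show ?thesis using m'(3) by (simp add: m1_def)
    qed
    ultimately show ?thesis using m' by auto
  qed
qed

text \<open>After division by \<open>q ^ k\<close> a polynomial competes with the powers of
  \<open>r\<close> = 1 + 1/\<open>q\<close>. Taking \<open>d\<close>-th roots leaves a linear
  function of \<open>k\<close> against the powers of \<open>x = root d r\<close>, which exceeds
  1.\<close>

lemma exp_beats_poly: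
  fixes c d q :: nat
  assumes "d > 0"
  shows "\<exists>k. (c * k + 1) ^ d * q ^ k < (q + 1) ^ k"
proof (cases "q = 0")
  case True
  then show ?thesis by (intro exI[of _ 1]) simp
next
  case False
  define r where "r = (real q + 1) / real q"
  have r: "r > 1" using False by (simp add: r_def)
  define x where "x = root d r"
  have x: "x > 1" using r assms by (simp add: x_def)
  have "(\<lambda>k. real c * (real k / x ^ k) + 1 / x ^ k) \<longlonglongrightarrow> real c * 0 + 0"
    using x by (intro tendsto_intros lim_n_over_pown LIMSEQ_divide_realpow_zero) auto
  then have "\<forall>\<^sub>F k in sequentially. real c * (real k / x ^ k) + 1 / x ^ k < 1"
    by (intro order_tendstoD(2)) auto
  then obtain k where k: "real c * (real k / x ^ k) + 1 / x ^ k < 1"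
    using eventually_happens trivial_limit_sequentially by blast
  have "real c * real k + 1 < x ^ k"
    using k x by (simp add: field_simps)
  then have "(real c * real k + 1) ^ d < (x ^ k) ^ d"
    using assms by (intro power_strict_mono) auto
  also have "(x ^ k) ^ d = r ^ k"
    using r assms by (simp add: x_def power_mult[symmetric] mult.commute[of k] power_mult)
  finally have "(real c * real k + 1) ^ d * real q ^ k < (real q + 1) ^ k"
    using False by (simp add: r_def power_divide field_simps)
  then have "real ((c * k + 1) ^ d * q ^ k) < real ((q + 1) ^ k)" by (simp add: add.commute)
  then show ?thesis by (metis of_nat_less_iff)
qed

text \<open>If all neighbours were matched for \<open>K\<close> rounds, expansion would make
  \<open>reach\<close> grow exponentially, beyond its polynomial bound; so a free neighbour appears
  and the path to it is augmented. Since \<open>K\<close> depends only on \<open>n\<close> and the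
  dimension, one radius \<open>R\<close> serves all sets and matchings.\<close>

lemma extend_matching:
  "\<exists>R. \<forall>(a :: (int ^ 'd) set) b m x.
     (\<forall>u. card (a \<inter> cube n u) < card (b \<inter> cube n u)) \<longrightarrow> matching a b n m \<longrightarrow> x \<in> a \<longrightarrow>
     (\<exists>m'. matching a b n m' \<and> dom m' = insert x (dom m) \<and>
        (\<forall>v. v - x \<notin> ball0 R \<longrightarrow> m' v = m v))"
proof -
  define q where "q = n ^ CARD('d)"
  obtain K where K: "(4 * n * K + 1) ^ CARD('d) * q ^ K < (q + 1) ^ K"
    using exp_beats_poly[of "CARD('d)" "4 * n" q] by auto
  show ?thesis
  proof (intro exI[of _ "2 * n * K"] allI impI)
    fix a b :: "(int ^ 'd) set" and m x
    assume cnt: "\<forall>u. card (a \<inter> cube n u) < card (b \<inter> cube n u)"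
      and m: "matching a b n m" and x: "x \<in> a"
    have "\<exists>k\<le>K. \<not> nbrs b n (reach b n m x k) \<subseteq> ran m"
    proof (rule ccontr)
      assume "\<not> ?thesis"
      then have sub: "nbrs b n (reach b n m x k) \<subseteq> ran m" if "k \<le> K" for k using that by blast
      \<comment> \<open>Growth by the factor 1 + 1/\<open>q\<close> per round, with denominators
        cleared to stay in the natural numbers.\<close>
      have "(q + 1) ^ k \<le> q ^ k * card (reach b n m x k)" if "k \<le> K" for k
        using that
      proof (induction k)
        case (Suc k)
        let ?N = "nbrs b n (reach b n m x k)"
        \<comment> \<open>By the assumption to be refuted every point of \<open>?N\<close> has a
          matching partner, and that partner enters \<open>reach\<close> in the next round.\<close>
        have "card ?N \<le> card (reach b n m x (Suc k))"
        proof (rule surj_card_le)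
          show "finite (reach b n m x (Suc k))" by (rule finite_reach[OF m])
          show "?N \<subseteq> (\<lambda>v. the (m v)) ` reach b n m x (Suc k)"
          proof
            fix w assume w: "w \<in> ?N"
            then obtain v where v: "m v = Some w" using sub[of k] Suc.prems by (auto simp: ran_def)
            then have "v \<in> reach b n m x (Suc k)" using w by auto
            then show "w \<in> (\<lambda>v. the (m v)) ` reach b n m x (Suc k)" using v by force
          qed
        qed
        moreover have "(q + 1) * card (reach b n m x k) \<le> q * card ?N"
          unfolding q_def using cnt finite_reach[OF m] reach_subset[OF m x]
          by (intro nbrs_expansion[where a = a]) auto
        ultimately have *: "(q + 1) * card (reach b n m x k) \<le> q * card (reach b n m x (Suc k))"
          by (meson mult_le_mono2 order_trans)
        have "(q + 1) ^ Suc k \<le> (q + 1) * (q ^ k * card (reach b n m x k))"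
          using Suc unfolding power_Suc by (intro mult_le_mono2) simp
        also have "\<dots> = q ^ k * ((q + 1) * card (reach b n m x k))" by (simp only: mult.left_commute)
        also have "\<dots> \<le> q ^ k * (q * card (reach b n m x (Suc k)))" using * by (rule mult_le_mono2)
        finally show ?case by (simp only: power_Suc mult_ac)
      qed simp
      from this[of K] have "(q + 1) ^ K \<le> q ^ K * (4 * n * K + 1) ^ CARD('d)"
        using finite_reach(2)[OF m, of x K] by (meson mult_le_mono2 order_refl order_trans)
      then show False using K by (simp add: mult.commute)
    qed
    then obtain k w where k: "k \<le> K" "w \<in> nbrs b n (reach b n m x k)" "w \<notin> ran m" by blast
    from augment[OF m x k(2,3)] obtain m' where m': "matching a b n m'"
      "dom m' = insert x (dom m)" "\<And>v. v - x \<notin> ball0 (2 * n * k) \<Longrightarrow> m' v = m v" by metis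
    moreover have "v - x \<notin> ball0 (2 * n * k)" if "v - x \<notin> ball0 (2 * n * K)" for v
      using that ball0_mono k(1) by (metis mult_le_mono2)
    ultimately show "\<exists>m'. matching a b n m' \<and> dom m' = insert x (dom m) \<and>
        (\<forall>v. v - x \<notin> ball0 (2 * n * K) \<longrightarrow> m' v = m v)" by blast
  qed
qed

section \<open>Locally constant functions and Cantor systems\<close>

abbreviation locally_const :: "'a topology \<Rightarrow> ('a \<Rightarrow> 'b) \<Rightarrow> bool" where
  "locally_const X f \<equiv> continuous_map X (discrete_topology UNIV) f"

lemma locally_const_iff:
  "locally_const X f \<longleftrightarrow>
     (\<forall>x \<in> topspace X. \<exists>U. openin X U \<and> x \<in> U \<and> (\<forall>y\<in>U. f x = f y))"
proof
  assume L: "locally_const X f"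
  show "\<forall>x \<in> topspace X. \<exists>U. openin X U \<and> x \<in> U \<and> (\<forall>y\<in>U. f x = f y)"
  proof
    fix x assume "x \<in> topspace X"
    moreover have "openin X {y \<in> topspace X. f y \<in> {f x}}"
      using openin_continuous_map_preimage[OF L, of "{f x}"] by simp
    ultimately show "\<exists>U. openin X U \<and> x \<in> U \<and> (\<forall>y\<in>U. f x = f y)"
      by (intro exI[of _ "{y \<in> topspace X. f y \<in> {f x}}"]) auto
  qed
next
  assume R: "\<forall>x \<in> topspace X. \<exists>U. openin X U \<and> x \<in> U \<and> (\<forall>y\<in>U. f x = f y)"
  have "openin X {x \<in> topspace X. f x \<in> V}" for V
  proof (subst openin_subopen, intro ballI)
    fix x assume x: "x \<in> {x \<in> topspace X. f x \<in> V}"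
    then have xt: "x \<in> topspace X" and xV: "f x \<in> V" by auto
    from bspec[OF R xt] obtain U where U: "openin X U" "x \<in> U" "\<forall>y\<in>U. f x = f y"
      by (elim exE conjE)
    have "U \<subseteq> {x \<in> topspace X. f x \<in> V}"
    proof
      fix y assume y: "y \<in> U"
      have "f y \<in> V" using bspec[OF U(3) y] xV by simp
      then show "y \<in> {x \<in> topspace X. f x \<in> V}" using y openin_subset[OF U(1)] by auto
    qed
    then show "\<exists>T. openin X T \<and> x \<in> T \<and> T \<subseteq> {x \<in> topspace X. f x \<in> V}"
      using U(1,2) by blast
  qed
  then show "locally_const X f" by (simp add: continuous_map)
qed

lemma locally_const_cong:
  assumes "\<And>x. x \<in> topspace X \<Longrightarrow> f x = g x"
  shows "locally_const X f \<longleftrightarrow> locally_const X g"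
  using assms continuous_map_eq by metis

text \<open>Finitely many neighbourhoods on which the \<open>f v\<close> are constant intersect in
  one on which \<open>g\<close> is. With \<open>v\<close> ranging over a ball, this shows that a
  rule inspecting a finite window of the orbit is locally constant.\<close>

lemma locally_const_window:
  assumes W: "finite W" "\<And>v. v \<in> W \<Longrightarrow> locally_const X (f v)"
    and dep: "\<And>x y. x \<in> topspace X \<Longrightarrow> y \<in> topspace X \<Longrightarrow>
                (\<And>v. v \<in> W \<Longrightarrow> f v x = f v y) \<Longrightarrow> g x = g y"
  shows "locally_const X g"
  unfolding locally_const_iff
proof
  fix x assume x: "x \<in> topspace X"
  have "\<forall>v\<in>W. \<exists>U. openin X U \<and> x \<in> U \<and> (\<forall>y\<in>U. f v x = f v y)"
  proof
    fix v assume "v \<in> W"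
    from W(2)[OF this, unfolded locally_const_iff] x
    show "\<exists>U. openin X U \<and> x \<in> U \<and> (\<forall>y\<in>U. f v x = f v y)" by (rule bspec)
  qed
  from bchoice[OF this] obtain U
    where U: "\<forall>v\<in>W. openin X (U v) \<and> x \<in> U v \<and> (\<forall>y\<in>U v. f v x = f v y)" ..
  have op: "openin X (U v)" and xU: "x \<in> U v" and eq: "y \<in> U v \<Longrightarrow> f v x = f v y"
    if "v \<in> W" for v y
    using bspec[OF U that] by simp_all
  \<comment> \<open>The factor \<open>topspace X\<close> covers the case of empty \<open>W\<close>,
    where the intersection over \<open>W\<close> is the whole type.\<close>
  let ?V = "topspace X \<inter> \<Inter> (U ` W)"
  have "openin X ?V"
  proof (cases "W = {}")
    case False
    then have "openin X (\<Inter> (U ` W))" using W(1) op by (intro openin_Inter) auto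
    then show ?thesis by (intro openin_Int) auto
  qed simp
  moreover have "x \<in> ?V" using x xU by blast
  moreover have "\<forall>y\<in>?V. g x = g y"
  proof
    fix y assume y: "y \<in> ?V"
    then have yt: "y \<in> topspace X" by blast
    show "g x = g y"
    proof (rule dep[OF x yt])
      fix v assume v: "v \<in> W"
      then show "f v x = f v y" using eq[OF v, of y] y by blast
    qed
  qed
  ultimately show "\<exists>U. openin X U \<and> x \<in> U \<and> (\<forall>y\<in>U. g x = g y)"
    by (intro exI[of _ ?V] conjI)
qed

lemma locally_const_dep:
  assumes "locally_const X f"
    and dep: "\<And>x y. x \<in> topspace X \<Longrightarrow> y \<in> topspace X \<Longrightarrow> f x = f y \<Longrightarrow> g x = g y"
  shows "locally_const X g"
proof (rule locally_const_window[where W = "{()}" and f = "\<lambda>_. f"])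
  fix x y assume "x \<in> topspace X" "y \<in> topspace X" "\<And>v. v \<in> {()} \<Longrightarrow> f x = f y"
  then show "g x = g y" by (intro dep) auto
qed (use assms(1) in simp_all)

lemma locally_const_dep2:
  assumes "locally_const X f" "locally_const X g"
    and "\<And>x y. x \<in> topspace X \<Longrightarrow> y \<in> topspace X \<Longrightarrow> f x = f y \<Longrightarrow> g x = g y \<Longrightarrow> h x = h y"
  shows "locally_const X h"
\<comment> \<open>The types of \<open>f\<close> and \<open>g\<close> may differ; the sum type makes
  them one family indexed by Booleans.\<close>
proof (rule locally_const_window[where W = "{True, False}" and
        f = "\<lambda>b x. if b then Inl (f x) else Inr (g x)"])
  have "locally_const X (\<lambda>x. Inl (f x))" "locally_const X (\<lambda>x. Inr (g x))"
    by (rule locally_const_dep[OF assms(1)], simp) (rule locally_const_dep[OF assms(2)], simp)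
  then show "locally_const X (\<lambda>x. if b then Inl (f x) else Inr (g x))" for b
    by (cases b) simp_all
next
  fix x y assume x: "x \<in> topspace X" and y: "y \<in> topspace X" and
    eq: "\<And>b. b \<in> {True, False} \<Longrightarrow>
      (if b then Inl (f x) else Inr (g x)) = (if b then Inl (f y) else Inr (g y))"
  have "f x = f y" using eq[of True] by simp
  moreover have "g x = g y" using eq[of False] by simp
  ultimately show "h x = h y" by (rule assms(3)[OF x y])
qed simp

lemma openin_locally_const: "locally_const X f \<Longrightarrow> openin X {x \<in> topspace X. P (f x)}"
  using openin_continuous_map_preimage[of X "discrete_topology UNIV" f "Collect P"] by auto

lemma clopenin_iff:
  "clopenin X A \<longleftrightarrow> A \<subseteq> topspace X \<and> locally_const X (\<lambda>x. x \<in> A)"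
proof
  assume A: "clopenin X A"
  then have "A \<subseteq> topspace X" using closedin_subset by (auto simp: clopenin_def)
  moreover have "locally_const X (\<lambda>x. x \<in> A)"
    unfolding locally_const_iff
  proof
    fix x assume "x \<in> topspace X"
    then show "\<exists>U. openin X U \<and> x \<in> U \<and> (\<forall>y\<in>U. (x \<in> A) = (y \<in> A))"
      by (intro exI[of _ "if x \<in> A then A else topspace X - A"]) (use A in \<open>auto simp: clopenin_def\<close>)
  qed
  ultimately show "A \<subseteq> topspace X \<and> locally_const X (\<lambda>x. x \<in> A)" by blast
next
  assume A: "A \<subseteq> topspace X \<and> locally_const X (\<lambda>x. x \<in> A)"
  then have "{x \<in> topspace X. x \<in> A} = A" "{x \<in> topspace X. x \<notin> A} = topspace X - A" by auto
  moreover have "openin X {x \<in> topspace X. x \<in> A}" "openin X {x \<in> topspace X. x \<notin> A}"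
    using A openin_locally_const[of X "\<lambda>x. x \<in> A" "\<lambda>b. b"] openin_locally_const[of X "\<lambda>x. x \<in> A" Not]
    by auto
  ultimately show "clopenin X A" using A by (simp add: clopenin_def closedin_def)
qed

lemma clopenin_level: "locally_const X f \<Longrightarrow> clopenin X {x \<in> topspace X. P (f x)}"
  unfolding clopenin_iff by (intro conjI, blast, erule locally_const_dep) auto

text \<open>Distinct points have distinct images in the product of two-point spaces, hence differ in
  some coordinate; a level set of that coordinate separates them.\<close>

lemma cantor_space_separation:
  assumes "cantor_space X" "x \<in> topspace X" "y \<in> topspace X" "x \<noteq> y"
  shows "\<exists>C. locally_const X (\<lambda>x. x \<in> C) \<and> x \<in> C \<and> y \<notin> C"
proof -
  let ?P = "product_topology (\<lambda>_::nat. discrete_topology (UNIV :: bool set)) UNIV"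
  obtain h k where hk: "homeomorphic_maps X ?P h k"
    using assms(1) by (auto simp: cantor_space_def homeomorphic_space_def)
  then have "h x \<noteq> h y" using assms by (metis homeomorphic_maps_def)
  then obtain n where n: "h x n \<noteq> h y n" by blast
  have "locally_const X ((\<lambda>f. f n) \<circ> h)"
    by (rule continuous_map_compose[where X' = ?P])
       (use hk in \<open>auto simp: homeomorphic_maps_def intro: continuous_map_product_projection\<close>)
  then have "locally_const X (\<lambda>z. z \<in> {z. h z n = h x n})"
    by (rule locally_const_dep) auto
  then show ?thesis using n by (intro exI[of _ "{z. h z n = h x n}"]) auto
qed

lemma Hausdorff_cantor_space: "cantor_space X \<Longrightarrow> Hausdorff_space X"
  unfolding cantor_space_def
  by (auto simp: homeomorphic_Hausdorff_space Hausdorff_space_product_topology)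

section \<open>Recurrence and separation in free minimal Cantor systems\<close>

locale fmc_system =
  fixes Z :: "'c topology" and \<alpha> :: "int ^ 'd \<Rightarrow> 'c \<Rightarrow> 'c"
  assumes sys: "free_minimal_cantor_system Z \<alpha>"
begin

lemma dyn: "dynamical_system Z \<alpha>" and cantor: "cantor_space Z"
  and free: "free_action Z \<alpha>" and minimal: "minimal_action Z \<alpha>"
  using sys by (simp_all add: free_minimal_cantor_system_def)

lemma compact: "compact_space Z" and homeo: "homeomorphic_map Z Z (\<alpha> v)"
  using dyn[unfolded dynamical_system_def, THEN conjunct1]
    dyn[unfolded dynamical_system_def, THEN conjunct2, THEN conjunct1] by auto

lemmas act_0 [simp] =
  dyn[unfolded dynamical_system_def, THEN conjunct2, THEN conjunct2, THEN conjunct1, THEN bspec]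

lemmas act_add =
  dyn[unfolded dynamical_system_def, THEN conjunct2, THEN conjunct2, THEN conjunct2,
    THEN spec, THEN spec, THEN bspec, symmetric]

lemma act_in [simp]: "z \<in> topspace Z \<Longrightarrow> \<alpha> v z \<in> topspace Z"
  using homeomorphic_imp_surjective_map[OF homeo] by blast

lemma act_eq_iff: "z \<in> topspace Z \<Longrightarrow> \<alpha> v z = \<alpha> w z \<longleftrightarrow> v = w"
proof
  assume z: "z \<in> topspace Z" and eq: "\<alpha> v z = \<alpha> w z"
  have "\<alpha> (v - w) z = \<alpha> (- w) (\<alpha> v z)" using z by (simp add: act_add)
  also have "\<dots> = z" unfolding eq using z by (simp add: act_add)
  finally have "v - w = 0" using free z unfolding free_action_def by blast
  then show "v = w" by simp
qed simp

lemma locally_const_act: "locally_const Z f \<Longrightarrow> locally_const Z (\<lambda>z. f (\<alpha> v z))"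
  using continuous_map_compose[OF homeomorphic_imp_continuous_map[OF homeo[of v]]]
  by (simp add: o_def)

lemma finite_range: "locally_const Z f \<Longrightarrow> finite (f ` topspace Z)"
  using image_compactin[of Z "topspace Z" "discrete_topology UNIV" f] compact
  by (simp add: compact_space_def compactin_discrete_topology)

lemma finite_subcover:
  assumes "\<And>z. z \<in> topspace Z \<Longrightarrow> openin Z (U z) \<and> z \<in> U z"
  shows "\<exists>F. finite F \<and> F \<subseteq> topspace Z \<and> topspace Z \<subseteq> (\<Union>z\<in>F. U z)"
proof -
  have "\<forall>V \<in> U ` topspace Z. openin Z V" "topspace Z \<subseteq> \<Union> (U ` topspace Z)"
    using assms by blast+
  then obtain \<F> where "finite \<F>" "\<F> \<subseteq> U ` topspace Z" "topspace Z \<subseteq> \<Union> \<F>"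
    using compact unfolding compact_space_alt by meson
  moreover then obtain F where "F \<subseteq> topspace Z" "finite F" "\<F> = U ` F"
    by (meson finite_subset_image)
  ultimately show ?thesis by blast
qed

text \<open>By minimality every orbit enters \<open>U\<close>, so the preimages of \<open>U\<close>
  under the action cover the space. Compactness leaves finitely many of them, and with them a bound
  uniform in \<open>z\<close>.\<close>

lemma orbit_meets:
  assumes "openin Z U" "U \<noteq> {}"
  shows "\<exists>k. \<forall>z \<in> topspace Z. \<exists>v \<in> ball0 k. \<alpha> v z \<in> U"
proof -
  have "\<exists>v. \<alpha> v z \<in> U" if z: "z \<in> topspace Z" for z
  proof -
    obtain u where u: "u \<in> U" using assms by blast
    then have "u \<in> topspace Z" using openin_subset[OF assms(1)] by blast
    then have "u \<in> Z closure_of (range (\<lambda>v. \<alpha> v z))"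
      using bspec[OF minimal[unfolded minimal_action_def] z] by simp
    then have "\<exists>y. y \<in> range (\<lambda>v. \<alpha> v z) \<and> y \<in> U" using u assms(1) by (simp only: in_closure_of)
    then show ?thesis by blast
  qed
  then have "\<forall>z \<in> topspace Z. \<exists>v. \<alpha> v z \<in> U" by simp
  from bchoice[OF this] obtain v where v: "\<forall>z \<in> topspace Z. \<alpha> (v z) z \<in> U" ..
  have op: "openin Z {y \<in> topspace Z. \<alpha> w y \<in> U}" for w
    using openin_continuous_map_preimage[OF homeomorphic_imp_continuous_map[OF homeo] assms(1)] .
  obtain F where F: "finite F" "F \<subseteq> topspace Z"
    "topspace Z \<subseteq> (\<Union>z\<in>F. {y \<in> topspace Z. \<alpha> (v z) y \<in> U})"
    using finite_subcover[of "\<lambda>z. {y \<in> topspace Z. \<alpha> (v z) y \<in> U}"] op v by auto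
  \<comment> \<open>A crude common bound for the finitely many vectors: the absolute values of all
    their coordinates are added.\<close>
  define k where "k = (\<Sum>z\<in>F. \<Sum>i\<in>UNIV. nat \<bar>v z $ i\<bar>)"
  have "v z \<in> ball0 k" if "z \<in> F" for z
    unfolding ball0_def
  proof (intro CollectI allI)
    fix i
    have "nat \<bar>v z $ i\<bar> \<le> (\<Sum>i\<in>UNIV. nat \<bar>v z $ i\<bar>)" by (rule member_le_sum) auto
    also have "\<dots> \<le> k" unfolding k_def
      by (rule member_le_sum[where f = "\<lambda>z. \<Sum>i\<in>UNIV. nat \<bar>v z $ i\<bar>"]) (use that F in auto)
    finally show "\<bar>v z $ i\<bar> \<le> int k" by linarith
  qed
  then have "\<exists>v \<in> ball0 k. \<alpha> v z \<in> U" if "z \<in> topspace Z" for z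
    using subsetD[OF F(3) that] by blast
  then show ?thesis by blast
qed

text \<open>By freeness a clopen \<open>C v\<close> contains \<open>z\<close> but not
  \<open>\<alpha> v z\<close>, for each nonzero \<open>v\<close>. Every point of \<open>V\<close>
  lies in \<open>C v\<close> while its translate by \<open>v\<close> does not, for the finitely many
  \<open>v\<close> at once, so the translate is outside \<open>V\<close>.\<close>

lemma separated_nbhd:
  assumes z: "z \<in> topspace Z"
  shows "\<exists>V. clopenin Z V \<and> z \<in> V \<and>
           (\<forall>y. \<forall>v \<in> ball0 k. y \<in> V \<longrightarrow> \<alpha> v y \<in> V \<longrightarrow> v = 0)"
proof -
  have "\<exists>C. locally_const Z (\<lambda>y. y \<in> C) \<and> z \<in> C \<and> \<alpha> v z \<notin> C" if "v \<noteq> 0" for v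
  proof -
    have "\<alpha> v z \<noteq> z" using act_eq_iff[OF z, of v 0] z that by simp
    then show ?thesis using cantor_space_separation[OF cantor z act_in[OF z], of v] by metis
  qed
  then obtain C where C: "\<And>v. v \<noteq> 0 \<Longrightarrow> locally_const Z (\<lambda>y. y \<in> C v) \<and> z \<in> C v \<and> \<alpha> v z \<notin> C v"
    by metis
  define V where
    "V = {y \<in> topspace Z. \<forall>v \<in> ball0 k - {0}. y \<in> C v \<and> \<alpha> v y \<notin> C v}"
  have "locally_const Z (\<lambda>y. y \<in> V)"
  proof (rule locally_const_window[where W = "ball0 k - {0}" and f = "\<lambda>v y. (y \<in> C v, \<alpha> v y \<in> C v)"])
    fix v :: "int ^ 'd" assume "v \<in> ball0 k - {0}"
    then have 1: "locally_const Z (\<lambda>y. y \<in> C v)" using C by blast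
    show "locally_const Z (\<lambda>y. (y \<in> C v, \<alpha> v y \<in> C v))"
      by (rule locally_const_dep2[OF 1 locally_const_act[OF 1]]) auto
  qed (auto simp: V_def finite_ball0)
  then have "clopenin Z V" unfolding clopenin_iff by (auto simp: V_def)
  moreover have "z \<in> V" using C z by (auto simp: V_def)
  moreover have "v = 0" if "v \<in> ball0 k" "y \<in> V" "\<alpha> v y \<in> V" for y v
    using that by (auto simp: V_def)
  ultimately show ?thesis by blast
qed

end

section \<open>Matchings along orbits\<close>

context fmc_system
begin

text \<open>A partial matching on the space is encoded by its displacement \<open>\<delta>\<close>: the point \<open>z\<close> is matched
  to \<open>\<alpha> w z\<close> if \<open>\<delta> z = Some w\<close>.\<close>

definition dmatching :: "'c set \<Rightarrow> 'c set \<Rightarrow> nat \<Rightarrow> ('c \<Rightarrow> (int ^ 'd) option) \<Rightarrow> bool" where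
  "dmatching A B n \<delta> \<longleftrightarrow> locally_const Z \<delta> \<and>
     (\<forall>z \<in> topspace Z. \<forall>w. \<delta> z = Some w \<longrightarrow> z \<in> A \<and> \<alpha> w z \<in> B \<and> w \<in> ball0 n) \<and>
     (\<forall>z \<in> topspace Z. \<forall>u w w'. \<delta> z = Some w \<longrightarrow> \<delta> (\<alpha> u z) = Some w' \<longrightarrow> w = w' + u \<longrightarrow> u = 0)"

text \<open>The third fact is injectivity: the partners of \<open>z\<close> and
  \<open>\<alpha> u z\<close> are \<open>\<alpha> w z\<close> and
  \<open>\<alpha> (w' + u) z\<close>, which coincide by freeness just when
  \<open>w = w' + u\<close>. Points on different orbits never compete.\<close>

lemma dmatchingD:
  assumes "dmatching A B n \<delta>"
  shows "locally_const Z \<delta>"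
    and "z \<in> topspace Z \<Longrightarrow> \<delta> z = Some w \<Longrightarrow> z \<in> A \<and> \<alpha> w z \<in> B \<and> w \<in> ball0 n"
    and "z \<in> topspace Z \<Longrightarrow> \<delta> z = Some w \<Longrightarrow> \<delta> (\<alpha> u z) = Some w' \<Longrightarrow> w = w' + u \<Longrightarrow> u = 0"
  using assms unfolding dmatching_def by metis+

text \<open>All points of \<open>V \<inter> A\<close> are augmented simultaneously. Seen from such a
  point its orbit is the lattice, and \<open>extend_matching\<close> gives an augmentation within
  radius \<open>R\<close>; the separation of \<open>V\<close> keeps these windows apart. The result
  is locally constant because each augmentation is chosen by a rule that inspects a finite
  window.\<close>

lemma extend_dmatching:
  assumes cnt: "\<And>z. z \<in> topspace Z \<Longrightarrow>
      card {v \<in> cube n 0. \<alpha> v z \<in> A} < card {v \<in> cube n 0. \<alpha> v z \<in> B}"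
    and A: "clopenin Z A" and B: "clopenin Z B"
  shows "\<exists>k. \<forall>\<delta> V. dmatching A B n \<delta> \<longrightarrow> clopenin Z V \<longrightarrow>
     (\<forall>y. \<forall>v \<in> ball0 k. y \<in> V \<longrightarrow> \<alpha> v y \<in> V \<longrightarrow> v = 0) \<longrightarrow>
     (\<exists>\<delta>'. dmatching A B n \<delta>' \<and>
        (\<forall>z \<in> topspace Z. \<delta>' z \<noteq> None \<longleftrightarrow> \<delta> z \<noteq> None \<or> z \<in> V \<inter> A))"
proof -
  obtain R where R: "\<And>(a :: (int ^ 'd) set) b m x.
     \<lbrakk>\<And>u. card (a \<inter> cube n u) < card (b \<inter> cube n u); matching a b n m; x \<in> a\<rbrakk> \<Longrightarrow>
     \<exists>m'. matching a b n m' \<and> dom m' = insert x (dom m) \<and> (\<forall>v. v - x \<notin> ball0 R \<longrightarrow> m' v = m v)"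
    using extend_matching[of n] by metis
  \<comment> \<open>Points with a common partner are at distance at most \<open>2 * n\<close>, so
    any conflict with a point within \<open>R\<close> is visible within \<open>S\<close>.\<close>
  define S where "S = R + 2 * n"
  show ?thesis
  \<comment> \<open>Separation by \<open>S + R\<close> keeps the \<open>S\<close>-window of one
    point of \<open>V\<close> away from the \<open>R\<close>-window of another.\<close>
  proof (intro exI[of _ "S + R"] allI impI)
    fix \<delta> V
    assume \<delta>: "dmatching A B n \<delta>" and V: "clopenin Z V"
      and sep: "\<forall>y. \<forall>v \<in> ball0 (S + R). y \<in> V \<longrightarrow> \<alpha> v y \<in> V \<longrightarrow> v = 0"
    note lc\<delta> = dmatchingD(1)[OF \<delta>] and val\<delta> = dmatchingD(2)[OF \<delta>] and inj\<delta> = dmatchingD(3)[OF \<delta>]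
    \<comment> \<open>The displacements seen from \<open>z\<close> once \<open>e\<close> has
      replaced them in the window of radius \<open>R\<close>.\<close>
    define upd where "upd z e v = (if v \<in> ball0 R then e v else \<delta> (\<alpha> v z))"
      for z and e :: "int ^ 'd \<Rightarrow> (int ^ 'd) option" and v
    \<comment> \<open>Admissibility of \<open>e\<close> as an augmentation at the origin: the domain
      gains at most \<open>0\<close>, the new edges are legitimate, and no two points of the
      \<open>S\<close>-window share a partner. Only the pattern of \<open>A\<close>,
      \<open>B\<close> and \<open>\<delta>\<close> on \<open>ball0 S\<close> enters.\<close>
    define P where "P z e \<longleftrightarrow>
        (\<forall>v \<in> ball0 R. (e v \<noteq> None \<longleftrightarrow> \<delta> (\<alpha> v z) \<noteq> None \<or> v = 0) \<and>
            (\<forall>w. e v = Some w \<longrightarrow> \<alpha> v z \<in> A \<and> \<alpha> (v + w) z \<in> B \<and> w \<in> ball0 n)) \<and>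
        (\<forall>v \<in> ball0 S. \<forall>v' \<in> ball0 S. \<forall>w w'.
            upd z e v = Some w \<longrightarrow> upd z e v' = Some w' \<longrightarrow> v + w = v' + w' \<longrightarrow> v = v')"
      for z and e :: "int ^ 'd \<Rightarrow> (int ^ 'd) option"
    \<comment> \<open>The choice depends on the predicate \<open>P z\<close> alone, so points with
      equal patterns receive the same augmentation. This is what makes \<open>E\<close> locally
      constant.\<close>
    define E where "E z = (SOME e. P z e)" for z
    have ball_sub: "v \<in> ball0 R \<Longrightarrow> v \<in> ball0 S" "v \<in> ball0 n \<Longrightarrow> v \<in> ball0 S" for v
      by (auto simp: S_def elim!: ball0_mono)

    have ex: "\<exists>e. P z e" if z: "z \<in> topspace Z" "z \<in> A" for z
    proof -
      define a where "a = {v. \<alpha> v z \<in> A}"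
      define b where "b = {v. \<alpha> v z \<in> B}"
      \<comment> \<open>Displacements are turned into positions on the orbit of \<open>z\<close>, as
        the lattice results require; \<open>e\<close> below turns the new matching back.\<close>
      define m where "m v = map_option ((+) v) (\<delta> (\<alpha> v z))" for v
      have shift: "card ({v. \<alpha> v z \<in> C} \<inter> cube n u) = card {v \<in> cube n 0. \<alpha> v (\<alpha> u z) \<in> C}" for C u
      proof (rule bij_betw_same_card[of "\<lambda>v. v - u"], rule bij_betw_byWitness[where f' = "\<lambda>v. v + u"])
      qed (auto simp: cube_def act_add z algebra_simps)
      have "card (a \<inter> cube n u) < card (b \<inter> cube n u)" for u
        using cnt[of "\<alpha> u z"] z by (simp add: a_def b_def shift)
      moreover have "matching a b n m"
        unfolding matching_def
      proof (intro conjI allI impI)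
        fix v w assume "m v = Some w"
        then obtain w' where w': "\<delta> (\<alpha> v z) = Some w'" "w = v + w'" by (auto simp: m_def)
        then have *: "\<alpha> v z \<in> A \<and> \<alpha> w' (\<alpha> v z) \<in> B \<and> w' \<in> ball0 n"
          using val\<delta>[OF act_in[OF z(1)]] by blast
        then show "v \<in> a" "w \<in> b" "w - v \<in> ball0 n"
          using w' z by (auto simp: a_def b_def act_add add.commute)
      next
        show "inj_on m (dom m)"
        proof (rule inj_onI)
          fix v v' assume "v \<in> dom m" "v' \<in> dom m" "m v = m v'"
          then obtain w w' where w: "\<delta> (\<alpha> v z) = Some w" "\<delta> (\<alpha> v' z) = Some w'" "v + w = v' + w'"
            by (auto simp: m_def)
          have "\<alpha> v' z = \<alpha> (v' - v) (\<alpha> v z)" using z by (simp add: act_add)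
          moreover have "w = w' + (v' - v)" using w(3) by (simp add: algebra_simps)
          ultimately have "v' - v = 0" using inj\<delta>[OF act_in[OF z(1)] w(1), of "v' - v" w'] w(2) by simp
          then show "v = v'" by simp
        qed
      qed
      moreover have "0 \<in> a" using z by (simp add: a_def)
      ultimately obtain m' where m': "matching a b n m'" "dom m' = insert 0 (dom m)"
        "\<And>v. v \<notin> ball0 R \<Longrightarrow> m' v = m v"
        using R[of a b m 0] by auto
      define e where "e v = map_option (\<lambda>w. w - v) (m' v)" for v
      \<comment> \<open>Outside \<open>ball0 R\<close> the new matching agrees with
        \<open>m\<close>, so \<open>upd z e\<close> encodes \<open>m'\<close> on the whole
        lattice.\<close>
      have mode: "upd z e v = map_option (\<lambda>w. w - v) (m' v)" for v
        by (cases "\<delta> (\<alpha> v z)") (auto simp: upd_def e_def m'(3) m_def)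
      have "P z e"
        unfolding P_def mode
      proof (intro conjI ballI allI impI)
        fix v :: "int ^ 'd"
        have "e v \<noteq> None \<longleftrightarrow> v \<in> dom m'" by (auto simp: e_def)
        then show "e v \<noteq> None \<longleftrightarrow> \<delta> (\<alpha> v z) \<noteq> None \<or> v = 0"
          unfolding m'(2) by (auto simp: m_def dom_def)
      next
        fix v w assume "e v = Some w"
        then have "m' v = Some (v + w)" by (auto simp: e_def)
        then have "v \<in> a \<and> v + w \<in> b \<and> (v + w) - v \<in> ball0 n"
          using m'(1) unfolding matching_def by blast
        then show "\<alpha> v z \<in> A" "\<alpha> (v + w) z \<in> B" "w \<in> ball0 n" by (auto simp: a_def b_def)
      next
        fix v v' w w'
        assume "map_option (\<lambda>w. w - v) (m' v) = Some w" "map_option (\<lambda>w. w - v') (m' v') = Some w'"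
          "v + w = v' + w'"
        then have "m' v = m' v'" "v \<in> dom m'" "v' \<in> dom m'" by auto
        then show "v = v'" using m'(1) by (auto simp: matching_def inj_on_def)
      qed
      then show ?thesis by blast
    qed
    have P_transfer: "P y e"
      if eq: "\<And>v. v \<in> ball0 S \<Longrightarrow> (\<alpha> v x \<in> A) = (\<alpha> v y \<in> A) \<and>
          (\<alpha> v x \<in> B) = (\<alpha> v y \<in> B) \<and> \<delta> (\<alpha> v x) = \<delta> (\<alpha> v y)"
        and P: "P x e" for x y e
      unfolding P_def
    proof (intro conjI ballI allI impI)
      fix v :: "int ^ 'd" assume v: "v \<in> ball0 R"
      show "(e v \<noteq> None) = (\<delta> (\<alpha> v y) \<noteq> None \<or> v = 0)"
        using P v eq[OF ball_sub(1)[OF v]] unfolding P_def by simp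
      fix w assume "e v = Some w"
      then have *: "\<alpha> v x \<in> A \<and> \<alpha> (v + w) x \<in> B \<and> w \<in> ball0 n"
        using P v unfolding P_def by blast
      then have "v + w \<in> ball0 (R + n)" using v by (blast intro: ball0_add)
      then have vw: "v + w \<in> ball0 S" by (rule ball0_mono) (simp add: S_def)
      show "\<alpha> v y \<in> A" "\<alpha> (v + w) y \<in> B" "w \<in> ball0 n"
        using * eq[OF ball_sub(1)[OF v]] eq[OF vw] by simp_all
    next
      fix v v' w w' assume v: "v \<in> ball0 S" "v' \<in> ball0 S"
        and w: "upd y e v = Some w" "upd y e v' = Some w'" "v + w = v' + w'"
      have "upd x e v = Some w" "upd x e v' = Some w'"
        using w eq[OF v(1)] eq[OF v(2)] unfolding upd_def by metis+
      then show "v = v'" using P v w(3) unfolding P_def by blast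
    qed
    have lcA: "locally_const Z (\<lambda>y. y \<in> A)" and lcB: "locally_const Z (\<lambda>y. y \<in> B)"
      and lcV: "locally_const Z (\<lambda>y. y \<in> V)"
      using A B V by (auto simp: clopenin_iff)
    have lcE: "locally_const Z E"
    proof (rule locally_const_window[where W = "ball0 S" and
          f = "\<lambda>v z. (\<alpha> v z \<in> A, \<alpha> v z \<in> B, \<delta> (\<alpha> v z))"])
      fix v
      have "locally_const Z (\<lambda>z. (z \<in> B, \<delta> z))"
        by (rule locally_const_dep2[OF lcB lc\<delta>]) auto
      then have "locally_const Z (\<lambda>z. (z \<in> A, z \<in> B, \<delta> z))"
        by (rule locally_const_dep2[OF lcA]) auto
      from locally_const_act[OF this]
      show "locally_const Z (\<lambda>z. (\<alpha> v z \<in> A, \<alpha> v z \<in> B, \<delta> (\<alpha> v z)))" .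
    next
      fix x y
      assume "x \<in> topspace Z" "y \<in> topspace Z"
      assume *: "\<And>v. v \<in> ball0 S \<Longrightarrow>
        (\<alpha> v x \<in> A, \<alpha> v x \<in> B, \<delta> (\<alpha> v x)) = (\<alpha> v y \<in> A, \<alpha> v y \<in> B, \<delta> (\<alpha> v y))"
      have "P x e \<longleftrightarrow> P y e" for e
        using P_transfer[of x y e] P_transfer[of y x e] * by auto
      then show "E x = E y" by (simp add: E_def)
    qed (rule finite_ball0)
    define T where "T = V \<inter> A"
    have T: "T \<subseteq> topspace Z" "T \<subseteq> A" "locally_const Z (\<lambda>z. z \<in> T)"
      using V A unfolding T_def clopenin_iff
      by (blast, blast, intro locally_const_dep2[OF lcV lcA]) auto
    have PE: "P z (E z)" if "z \<in> T" for z
      unfolding E_def using someI_ex[OF ex] that T by blast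
    \<comment> \<open>The point \<open>y\<close> sits at position \<open>v\<close> in the
      \<open>R\<close>-window of the root \<open>\<alpha> (- v) y\<close>, an element of
      \<open>T\<close> at which an augmentation is made.\<close>
    define near where "near y v \<longleftrightarrow> v \<in> ball0 R \<and> \<alpha> (- v) y \<in> T" for y v
    define d where
      "d y = (if \<exists>v. near y v then let v = SOME v. near y v in E (\<alpha> (- v) y) v else \<delta> y)" for y
    \<comment> \<open>Otherwise two distinct roots would differ by a vector of
      \<open>ball0 (S + R)\<close>, against \<open>sep\<close>. Hence the \<open>SOME\<close> in
      \<open>d\<close> has no real choice.\<close>
    have near_uniq: "v' = v" if "z \<in> T" "v \<in> ball0 S" "near (\<alpha> v z) v'" for z v v'
    proof -
      have "\<alpha> (v - v') z \<in> T" "v' \<in> ball0 R"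
        using that T by (auto simp: near_def act_add subset_iff)
      moreover then have "v - v' \<in> ball0 (S + R)" using that ball0_diff by blast
      ultimately have "v - v' = 0" using sep that(1) unfolding T_def by blast
      then show ?thesis by simp
    qed
    have d_mod: "d (\<alpha> v z) = upd z (E z) v" if "z \<in> T" "v \<in> ball0 S" for z v
    proof (cases "v \<in> ball0 R")
      case True
      then have n: "near (\<alpha> v z) v" using that T by (auto simp: near_def act_add subset_iff)
      then have "(SOME v'. near (\<alpha> v z) v') = v"
        using near_uniq[OF that] by (intro some_equality) auto
      moreover have "\<alpha> (- v) (\<alpha> v z) = z" using that T by (auto simp: act_add subset_iff)
      ultimately show ?thesis using n True unfolding d_def upd_def by (auto simp: Let_def)
    next
      case False
      then have "\<not> near (\<alpha> v z) v'" for v' using near_uniq[OF that] by (auto simp: near_def)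
      then show ?thesis using False by (auto simp: d_def upd_def)
    qed
    have d_cases: "(\<exists>z \<in> T. \<exists>v \<in> ball0 R. y = \<alpha> v z) \<or> (\<forall>v. \<not> near y v) \<and> d y = \<delta> y"
      if "y \<in> topspace Z" for y
    proof (cases "\<exists>v. near y v")
      case True
      then obtain v where v: "v \<in> ball0 R" "\<alpha> (- v) y \<in> T" by (auto simp: near_def)
      moreover have "y = \<alpha> v (\<alpha> (- v) y)" using that by (simp add: act_add)
      ultimately show ?thesis by metis
    qed (auto simp: d_def)
    \<comment> \<open>The value \<open>d y\<close> is determined by \<open>\<delta> y\<close> and a
      finite table: membership in \<open>T\<close> and the value of \<open>E\<close> at the
      translates of \<open>y\<close> by vectors of \<open>ball0 R\<close>.\<close>
    have lcd: "locally_const Z d"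
    proof (rule locally_const_dep2)
      show "locally_const Z \<delta>" by (rule lc\<delta>)
      show "locally_const Z (\<lambda>y. restrict (\<lambda>v. (\<alpha> (- v) y \<in> T, E (\<alpha> (- v) y))) (ball0 R))"
      proof (rule locally_const_window[where W = "ball0 R" and
            f = "\<lambda>v y. (\<alpha> (- v) y \<in> T, E (\<alpha> (- v) y))"])
        fix v
        have "locally_const Z (\<lambda>y. (y \<in> T, E y))" by (rule locally_const_dep2[OF T(3) lcE]) auto
        from locally_const_act[OF this]
        show "locally_const Z (\<lambda>y. (\<alpha> (- v) y \<in> T, E (\<alpha> (- v) y)))" .
      qed (auto simp: finite_ball0 intro: restrict_ext)
      fix x y assume 1: "\<delta> x = \<delta> y" and
        eq: "restrict (\<lambda>v. (\<alpha> (- v) x \<in> T, E (\<alpha> (- v) x))) (ball0 R) =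
          restrict (\<lambda>v. (\<alpha> (- v) y \<in> T, E (\<alpha> (- v) y))) (ball0 R)"
      have 2: "(\<alpha> (- v) x \<in> T, E (\<alpha> (- v) x)) = (\<alpha> (- v) y \<in> T, E (\<alpha> (- v) y))"
        if "v \<in> ball0 R" for v
        using fun_cong[OF eq, of v] that by simp
      have 3: "near x = near y" unfolding near_def using 2 by auto
      show "d x = d y"
      proof (cases "\<exists>v. near x v")
        case True
        define v where "v = (SOME v. near x v)"
        have "v \<in> ball0 R" using someI_ex[OF True] by (simp add: v_def near_def)
        then show ?thesis using True 2[of v] unfolding d_def v_def by (simp add: 3 Let_def)
      next
        case False
        then show ?thesis using 1 by (simp add: d_def 3)
      qed
    qed
    have dom: "d y \<noteq> None \<longleftrightarrow> \<delta> y \<noteq> None \<or> y \<in> V \<inter> A" if y: "y \<in> topspace Z" for y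
      using d_cases[OF y]
    proof (elim disjE bexE conjE)
      fix z v assume zv: "z \<in> T" "v \<in> ball0 R" "y = \<alpha> v z"
      have "d y \<noteq> None \<longleftrightarrow> \<delta> y \<noteq> None \<or> v = 0"
        using PE[OF zv(1)] d_mod[OF zv(1) ball_sub(1)[OF zv(2)]] zv by (auto simp: P_def upd_def)
      moreover have "v = 0 \<longleftrightarrow> y \<in> T"
      proof
        assume "y \<in> T"
        then have "near (\<alpha> v z) 0" using y zv by (simp add: near_def)
        then show "v = 0" using near_uniq[OF zv(1) ball_sub(1)[OF zv(2)]] by blast
      qed (use zv T in auto)
      ultimately show ?thesis by (simp add: T_def)
    next
      assume "\<forall>v. \<not> near y v" "d y = \<delta> y"
      moreover have "y \<notin> T"
      proof
        assume "y \<in> T"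
        then have "near y 0" using y by (simp add: near_def)
        then show False using \<open>\<forall>v. \<not> near y v\<close> by blast
      qed
      ultimately show ?thesis by (auto simp: T_def)
    qed
    have val: "y \<in> A \<and> \<alpha> w y \<in> B \<and> w \<in> ball0 n" if y: "y \<in> topspace Z" "d y = Some w" for y w
      using d_cases[OF y(1)]
    proof (elim disjE bexE conjE)
      fix z v assume zv: "z \<in> T" "v \<in> ball0 R" "y = \<alpha> v z"
      then have "E z v = Some w" using d_mod[OF zv(1) ball_sub(1)[OF zv(2)]] y by (simp add: upd_def)
      then have "\<alpha> v z \<in> A \<and> \<alpha> (v + w) z \<in> B \<and> w \<in> ball0 n"
        using PE[OF zv(1)] zv(2) by (auto simp: P_def)
      then show ?thesis using zv T by (auto simp: act_add subset_iff add.commute)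
    qed (use val\<delta>[OF y(1), of w] y(2) in simp)
    \<comment> \<open>A competitor of a point in the \<open>R\<close>-window lies in the
      \<open>S\<close>-window of the same root, where \<open>P\<close> excludes it.\<close>
    have inj_near: "u = 0"
      if zv: "z \<in> T" "v \<in> ball0 R" and w: "d (\<alpha> v z) = Some w" "d (\<alpha> u (\<alpha> v z)) = Some w'" "w = w' + u"
      for z v u w w'
    proof -
      have z: "z \<in> topspace Z" using zv T by blast
      have "w \<in> ball0 n" "w' \<in> ball0 n"
        using val[OF act_in[OF z] w(1)] val[OF act_in[OF act_in[OF z]] w(2)] by auto
      then have "(w - w') + v \<in> ball0 ((n + n) + R)" by (intro ball0_add ball0_diff zv(2))
      then have uv: "u + v \<in> ball0 S" using w(3) by (simp add: S_def add.commute mult_2)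
      have "upd z (E z) v = Some w" using w d_mod[OF zv(1) ball_sub(1)[OF zv(2)]] by simp
      moreover have "upd z (E z) (u + v) = Some w'" using w d_mod[OF zv(1) uv] z by (simp add: act_add)
      moreover have "v + w = (u + v) + w'" using w(3) by simp
      ultimately have "v = u + v" using PE[OF zv(1)] ball_sub(1)[OF zv(2)] uv
        unfolding P_def by blast
      then show ?thesis by simp
    qed
    have inj: "u = 0"
      if y: "y \<in> topspace Z" and w: "d y = Some w" "d (\<alpha> u y) = Some w'" "w = w' + u" for y u w w'
      using d_cases[OF y]
    proof (elim disjE bexE conjE)
      fix z v assume "z \<in> T" "v \<in> ball0 R" "y = \<alpha> v z"
      then show ?thesis using inj_near w by blast
    next
      assume 1: "d y = \<delta> y"
      show ?thesis using d_cases[OF act_in[OF y, of u]]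
      proof (elim disjE bexE conjE)
        \<comment> \<open>Now the second point is the one in a window; the roles are exchanged and
          \<open>u\<close> changes sign.\<close>
        fix z v assume zv: "z \<in> T" "v \<in> ball0 R" "\<alpha> u y = \<alpha> v z"
        have "\<alpha> (- u) (\<alpha> v z) = y" using y unfolding zv(3)[symmetric] by (simp add: act_add)
        then have "d (\<alpha> (- u) (\<alpha> v z)) = Some w" using w(1) by simp
        moreover have "d (\<alpha> v z) = Some w'" using w(2) zv(3) by simp
        moreover have "w' = w + - u" using w(3) by simp
        ultimately have "- u = 0" using inj_near[OF zv(1,2)] by blast
        then show ?thesis by simp
      next
        assume "d (\<alpha> u y) = \<delta> (\<alpha> u y)"
        then show ?thesis using inj\<delta>[OF y, of w u w'] w 1 by simp
      qed
    qed
    have "dmatching A B n d"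
      unfolding dmatching_def
    proof (intro conjI ballI allI impI lcd)
      fix z w assume "z \<in> topspace Z" "d z = Some w"
      from val[OF this] show "z \<in> A" "\<alpha> w z \<in> B" "w \<in> ball0 n" by simp_all
    next
      fix z u w w' assume "z \<in> topspace Z" "d z = Some w" "d (\<alpha> u z) = Some w'" "w = w' + u"
      then show "u = 0" by (rule inj)
    qed
    then show "\<exists>\<delta>'. dmatching A B n \<delta>' \<and>
        (\<forall>z \<in> topspace Z. \<delta>' z \<noteq> None \<longleftrightarrow> \<delta> z \<noteq> None \<or> z \<in> V \<inter> A)"
      using dom by blast
  qed
qed

text \<open>Finitely many sets from \<open>separated_nbhd\<close> cover the space and are treated in
  turn, starting from the empty matching. A matched point may change its partner later but stays
  matched.\<close>

lemma total_dmatching: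
  assumes cnt: "\<And>z. z \<in> topspace Z \<Longrightarrow>
      card {v \<in> cube n 0. \<alpha> v z \<in> A} < card {v \<in> cube n 0. \<alpha> v z \<in> B}"
    and A: "clopenin Z A" and B: "clopenin Z B"
  shows "\<exists>\<delta>. dmatching A B n \<delta> \<and> (\<forall>z\<in>A. \<delta> z \<noteq> None)"
proof -
  from extend_dmatching[OF assms] obtain k where k: "\<forall>\<delta> V. dmatching A B n \<delta> \<longrightarrow> clopenin Z V \<longrightarrow>
     (\<forall>y. \<forall>v \<in> ball0 k. y \<in> V \<longrightarrow> \<alpha> v y \<in> V \<longrightarrow> v = 0) \<longrightarrow>
     (\<exists>\<delta>'. dmatching A B n \<delta>' \<and>
        (\<forall>z \<in> topspace Z. \<delta>' z \<noteq> None \<longleftrightarrow> \<delta> z \<noteq> None \<or> z \<in> V \<inter> A))" ..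
  have "\<forall>z \<in> topspace Z. \<exists>V. clopenin Z V \<and> z \<in> V \<and>
      (\<forall>y. \<forall>v \<in> ball0 k. y \<in> V \<longrightarrow> \<alpha> v y \<in> V \<longrightarrow> v = 0)"
    using separated_nbhd by simp
  from bchoice[OF this] obtain V where V: "\<forall>z \<in> topspace Z. clopenin Z (V z) \<and> z \<in> V z \<and>
      (\<forall>y. \<forall>v \<in> ball0 k. y \<in> V z \<longrightarrow> \<alpha> v y \<in> V z \<longrightarrow> v = 0)" ..
  obtain F where F: "finite F" "F \<subseteq> topspace Z" "topspace Z \<subseteq> (\<Union>z\<in>F. V z)"
    using finite_subcover[of V] V unfolding clopenin_def by auto
  have "\<exists>\<delta>. dmatching A B n \<delta> \<and> (\<forall>z \<in> topspace Z. z \<in> (\<Union>x\<in>F. V x) \<inter> A \<longrightarrow> \<delta> z \<noteq> None)"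
    using F(1,2)
  proof (induction F)
    case empty
    have "dmatching A B n (\<lambda>_. None)" by (auto simp: dmatching_def)
    then show ?case by auto
  next
    case (insert x F)
    then obtain \<delta> where \<delta>: "dmatching A B n \<delta>"
      "\<And>z. z \<in> topspace Z \<Longrightarrow> z \<in> (\<Union>x\<in>F. V x) \<inter> A \<Longrightarrow> \<delta> z \<noteq> None" by auto
    from insert.prems have "x \<in> topspace Z" by blast
    from bspec[OF V this] have "clopenin Z (V x)"
      "\<forall>y. \<forall>v \<in> ball0 k. y \<in> V x \<longrightarrow> \<alpha> v y \<in> V x \<longrightarrow> v = 0"
      by simp_all
    from k[THEN spec, THEN spec, THEN mp, THEN mp, THEN mp, OF \<delta>(1) this]
    obtain \<delta>' where "dmatching A B n \<delta>'"
      "\<forall>z \<in> topspace Z. \<delta>' z \<noteq> None \<longleftrightarrow> \<delta> z \<noteq> None \<or> z \<in> V x \<inter> A" by blast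
    then show ?case using \<delta>(2) by (intro exI[of _ \<delta>']) blast
  qed
  then show ?thesis using F(3) A unfolding clopenin_iff by blast
qed

end

section \<open>The ordered group\<close>

lemma carrier_CZ: "f \<in> carrier (CZ X) \<longleftrightarrow> f \<in> extensional (topspace X) \<and> locally_const X f"
  by (simp add: CZ_def)

lemma mult_CZ: "f \<otimes>\<^bsub>CZ X\<^esub> g = (\<lambda>x \<in> topspace X. f x + g x)"
  and one_CZ: "\<one>\<^bsub>CZ X\<^esub> = (\<lambda>x \<in> topspace X. 0)"
  by (simp_all add: CZ_def)

lemma restrict_carrier_CZ: "locally_const X f \<Longrightarrow> restrict f (topspace X) \<in> carrier (CZ X)"
  unfolding carrier_CZ using locally_const_cong[of X "restrict f (topspace X)" f] by simp

lemma ind_carrier: "clopenin X A \<Longrightarrow> ind X A \<in> carrier (CZ X)"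
  unfolding ind_def clopenin_iff
  by (rule restrict_carrier_CZ, elim conjE, erule locally_const_dep) (simp add: indicator_def)

lemma comm_group_CZ: "comm_group (CZ X)"
proof (rule comm_groupI)
  fix f g assume f: "f \<in> carrier (CZ X)" and g: "g \<in> carrier (CZ X)"
  have "locally_const X (\<lambda>x. f x + g x)"
    by (rule locally_const_dep2[of X f g]) (use f g in \<open>auto simp: carrier_CZ\<close>)
  then show "f \<otimes>\<^bsub>CZ X\<^esub> g \<in> carrier (CZ X)" unfolding mult_CZ by (rule restrict_carrier_CZ)
  show "f \<otimes>\<^bsub>CZ X\<^esub> g = g \<otimes>\<^bsub>CZ X\<^esub> f" by (simp add: mult_CZ add.commute)
  fix h assume "h \<in> carrier (CZ X)"
  show "f \<otimes>\<^bsub>CZ X\<^esub> g \<otimes>\<^bsub>CZ X\<^esub> h = f \<otimes>\<^bsub>CZ X\<^esub> (g \<otimes>\<^bsub>CZ X\<^esub> h)"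
    by (auto simp: mult_CZ add.assoc intro!: restrict_ext)
next
  show "\<one>\<^bsub>CZ X\<^esub> \<in> carrier (CZ X)" unfolding one_CZ by (rule restrict_carrier_CZ) simp
  fix f assume f: "f \<in> carrier (CZ X)"
  show "\<one>\<^bsub>CZ X\<^esub> \<otimes>\<^bsub>CZ X\<^esub> f = f"
    using f by (auto simp: mult_CZ one_CZ carrier_CZ extensional_def fun_eq_iff)
  have "locally_const X (\<lambda>x. - f x)"
    by (rule locally_const_dep[of X f]) (use f in \<open>auto simp: carrier_CZ\<close>)
  then show "\<exists>g \<in> carrier (CZ X). g \<otimes>\<^bsub>CZ X\<^esub> f = \<one>\<^bsub>CZ X\<^esub>"
    by (intro bexI[OF _ restrict_carrier_CZ]) (auto simp: mult_CZ one_CZ intro!: restrict_ext)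
qed

interpretation CZ: comm_group "CZ X" for X
  by (rule comm_group_CZ)

lemma inv_CZ:
  assumes f: "f \<in> carrier (CZ X)"
  shows "inv\<^bsub>CZ X\<^esub> f = (\<lambda>x \<in> topspace X. - f x)"
proof (rule CZ.inv_equality)
  have "locally_const X (\<lambda>x. - f x)"
    by (rule locally_const_dep[of X f]) (use f in \<open>auto simp: carrier_CZ\<close>)
  then show "(\<lambda>x \<in> topspace X. - f x) \<in> carrier (CZ X)" by (rule restrict_carrier_CZ)
qed (auto simp: mult_CZ one_CZ f intro!: restrict_ext)

lemma diff_CZ:
  assumes "f \<in> carrier (CZ X)" "g \<in> carrier (CZ X)"
  shows "f \<otimes>\<^bsub>CZ X\<^esub> inv\<^bsub>CZ X\<^esub> g = (\<lambda>x \<in> topspace X. f x - g x)"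
  using assms by (auto simp: mult_CZ inv_CZ intro!: restrict_ext)

section \<open>The quotient by the coboundaries\<close>

context fmc_system
begin

lemma act_image: "A \<subseteq> topspace Z \<Longrightarrow> \<alpha> v ` A = {z \<in> topspace Z. \<alpha> (- v) z \<in> A}"
proof (intro subset_antisym subsetI)
  fix z assume A: "A \<subseteq> topspace Z" and z: "z \<in> {z \<in> topspace Z. \<alpha> (- v) z \<in> A}"
  then have "z = \<alpha> v (\<alpha> (- v) z)" by (simp add: act_add)
  then show "z \<in> \<alpha> v ` A" using z by blast
qed (auto simp: act_add subset_iff)

lemma clopenin_act: "clopenin Z A \<Longrightarrow> clopenin Z (\<alpha> v ` A)"
  using clopenin_level[OF locally_const_act[of "\<lambda>z. z \<in> A" "- v"], of "\<lambda>b. b"]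
  by (simp add: act_image clopenin_iff)

lemma ind_act:
  "A \<subseteq> topspace Z \<Longrightarrow> z \<in> topspace Z \<Longrightarrow> ind Z (\<alpha> v ` A) z = ind Z A (\<alpha> (- v) z)"
  by (simp add: ind_def act_image indicator_def)

lemma generator_carrier:
  "clopenin Z A \<Longrightarrow> (\<lambda>x \<in> topspace Z. ind Z A x - ind Z (\<alpha> v ` A) x) \<in> carrier (CZ Z)"
  using diff_CZ[OF ind_carrier ind_carrier[OF clopenin_act[of A v]], of A]
    CZ.m_closed CZ.inv_closed ind_carrier clopenin_act by metis

lemma subgroup_coboundaries: "subgroup (coboundaries Z \<alpha>) (CZ Z)"
  unfolding coboundaries_def by (rule CZ.generate_is_subgroup) (use generator_carrier in blast)

lemma normal_coboundaries: "coboundaries Z \<alpha> \<lhd> CZ Z"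
  by (simp add: CZ.normal_iff_subgroup subgroup_coboundaries)

lemma cls_eq_iff:
  assumes "f \<in> carrier (CZ Z)" "g \<in> carrier (CZ Z)"
  shows "cls Z \<alpha> f = cls Z \<alpha> g \<longleftrightarrow> (\<lambda>x \<in> topspace Z. f x - g x) \<in> coboundaries Z \<alpha>"
proof -
  interpret subgroup "coboundaries Z \<alpha>" "CZ Z" by (rule subgroup_coboundaries)
  have "cls Z \<alpha> f = cls Z \<alpha> g \<longleftrightarrow> f \<in> cls Z \<alpha> g"
    using CZ.rcos_self[OF assms(1) subgroup_coboundaries]
      CZ.repr_independence[OF _ assms(2) subgroup_coboundaries, of f]
    by (auto simp: cls_def)
  also have "\<dots> \<longleftrightarrow> f \<otimes>\<^bsub>CZ Z\<^esub> inv\<^bsub>CZ Z\<^esub> g \<in> coboundaries Z \<alpha>"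
    unfolding cls_def by (rule rcos_module) (use assms comm_group_CZ in \<open>auto simp: comm_group_def\<close>)
  finally show ?thesis by (simp add: diff_CZ assms)
qed

lemma cls_mult:
  "f \<in> carrier (CZ Z) \<Longrightarrow> g \<in> carrier (CZ Z) \<Longrightarrow>
     cls Z \<alpha> f \<otimes>\<^bsub>GZ Z \<alpha>\<^esub> cls Z \<alpha> g = cls Z \<alpha> (f \<otimes>\<^bsub>CZ Z\<^esub> g)"
  using normal.rcos_sum[OF normal_coboundaries] by (simp add: cls_def GZ_def)

lemma group_GZ: "group (GZ Z \<alpha>)"
  unfolding GZ_def by (rule normal.factorgroup_is_group[OF normal_coboundaries])

lemma cls_hom: "cls Z \<alpha> \<in> hom (CZ Z) (GZ Z \<alpha>)"
  using normal.r_coset_hom_Mod[OF normal_coboundaries] by (simp add: cls_def[abs_def] GZ_def)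

lemma cls_inv:
  assumes "f \<in> carrier (CZ Z)"
  shows "inv\<^bsub>GZ Z \<alpha>\<^esub> (cls Z \<alpha> f) = cls Z \<alpha> (inv\<^bsub>CZ Z\<^esub> f)"
proof -
  interpret group_hom "CZ Z" "GZ Z \<alpha>" "cls Z \<alpha>"
    by (intro group_hom.intro group_hom_axioms.intro CZ.is_group group_GZ cls_hom)
  show ?thesis using assms by simp
qed

end

section \<open>Cube sums of coboundaries\<close>

lemma cube_uminus: "cube n (- w) = (\<lambda>v. v - w) ` cube n 0"
proof (intro subset_antisym subsetI)
  fix v assume "v \<in> cube n (- w)"
  then have "v + w \<in> cube n 0" by (auto simp: cube_def) (smt (verit))+
  then show "v \<in> (\<lambda>v. v - w) ` cube n 0" by (rule rev_image_eqI) simp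
qed (auto simp: cube_def)

text \<open>Both cubes contain the cube of side \<open>n - 2 * k\<close> whose lower corner has all
  coordinates \<open>k\<close>, so each difference lies in a shell around it.\<close>

lemma card_cube_diff:
  fixes w :: "int ^ 'd"
  assumes "w \<in> ball0 k" "2 * k \<le> n"
  shows "card (cube n 0 - cube n w) \<le> n ^ CARD('d) - (n - 2 * k) ^ CARD('d)"
    and "card (cube n w - cube n 0) \<le> n ^ CARD('d) - (n - 2 * k) ^ CARD('d)"
proof -
  let ?I = "cube (n - 2 * k) (\<chi> i. int k) :: (int ^ 'd) set"
  have w: "\<bar>w $ i\<bar> \<le> int k" for i using assms(1) by (simp add: ball0_def)
  have I: "?I \<subseteq> cube n 0" "?I \<subseteq> cube n w"
  proof -
    show "?I \<subseteq> cube n 0"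
    proof
      fix v assume v: "v \<in> ?I"
      have "0 \<le> v $ i \<and> v $ i < int n" for i
      proof -
        have "int k \<le> v $ i \<and> v $ i < int k + int (n - 2 * k)" using v by (simp add: cube_def)
        then show ?thesis using assms(2) by linarith
      qed
      then show "v \<in> cube n 0" by (simp add: cube_def)
    qed
    show "?I \<subseteq> cube n w"
    proof
      fix v assume v: "v \<in> ?I"
      have "w $ i \<le> v $ i \<and> v $ i < w $ i + int n" for i
      proof -
        have "int k \<le> v $ i \<and> v $ i < int k + int (n - 2 * k)" using v by (simp add: cube_def)
        then show ?thesis using w[of i] assms(2) by linarith
      qed
      then show "v \<in> cube n w" by (simp add: cube_def)
    qed
  qed
  have "card (C - C') \<le> n ^ CARD('d) - (n - 2 * k) ^ CARD('d)"
    if "?I \<subseteq> C" "?I \<subseteq> C'" "C = cube n u" for C C' u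
  proof -
    have "card (C - C') \<le> card (C - ?I)" using that by (intro card_mono) auto
    also have "\<dots> = card C - card ?I" using that by (intro card_Diff_subset) auto
    finally show ?thesis by (simp add: that(3) card_cube)
  qed
  from this[OF I refl] this[OF I(2,1) refl]
  show "card (cube n 0 - cube n w) \<le> n ^ CARD('d) - (n - 2 * k) ^ CARD('d)"
    "card (cube n w - cube n 0) \<le> n ^ CARD('d) - (n - 2 * k) ^ CARD('d)" .
qed

text \<open>For \<open>n > 2 * k\<close> the shell has relative volume
  \<open>1 - (1 - 2 * k / n) ^ d\<close>, which tends to 0.\<close>

lemma shell_negligible:
  assumes "e > 0"
  shows "\<forall>\<^sub>F n in sequentially. real (n ^ d - (n - 2 * k) ^ d) \<le> e * real n ^ d"
proof -
  have "(\<lambda>n. (1 - real (2 * k) / real n) ^ d) \<longlonglongrightarrow> (1 - 0) ^ d"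
    by (intro tendsto_intros lim_const_over_n)
  then have "\<forall>\<^sub>F n in sequentially. 1 - e < (1 - real (2 * k) / real n) ^ d"
    using assms by (intro order_tendstoD(1)) auto
  moreover have "\<forall>\<^sub>F n in sequentially. n > 2 * k" by (rule eventually_gt_at_top)
  ultimately show ?thesis
  proof eventually_elim
    case (elim n)
    then have n: "real n > 0" by simp
    have "(1 - real (2 * k) / real n) * real n = real (n - 2 * k)"
      using elim n by (simp add: field_simps of_nat_diff)
    then have "(1 - real (2 * k) / real n) ^ d * real n ^ d = real (n - 2 * k) ^ d"
      by (metis power_mult_distrib)
    then have "(1 - e) * real n ^ d \<le> real (n - 2 * k) ^ d"
      using elim n by (metis less_eq_real_def mult_right_mono zero_le_power)
    moreover have "(n - 2 * k) ^ d \<le> n ^ d" by (simp add: power_mono)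
    ultimately show ?case by (simp add: of_nat_diff algebra_simps)
  qed
qed

context fmc_system
begin

text \<open>Summing the indicator of the translate of \<open>A\<close> over a cube amounts to
  summing that of \<open>A\<close> over the cube shifted by \<open>- w\<close>. The two sums cancel
  on the overlap and leave at most a shell, uniformly in \<open>z\<close>.\<close>

lemma sum_generator_small:
  assumes A: "clopenin Z A" and h: "h = (\<lambda>x \<in> topspace Z. ind Z A x - ind Z (\<alpha> w ` A) x)"
    and e: "e > 0"
  shows "\<exists>N. \<forall>n\<ge>N. \<forall>z \<in> topspace Z.
           \<bar>real_of_int (\<Sum>v \<in> cube n 0. h (\<alpha> v z))\<bar> \<le> e * real n ^ CARD('d)"
proof -
  have At: "A \<subseteq> topspace Z" using A by (simp add: clopenin_iff)
  define k where "k = (\<Sum>i\<in>UNIV. nat \<bar>w $ i\<bar>)"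
  have w: "- w \<in> ball0 k"
    unfolding ball0_minus unfolding ball0_def
  proof (intro CollectI allI)
    fix i
    have "nat \<bar>w $ i\<bar> \<le> k" unfolding k_def by (rule member_le_sum) auto
    then show "\<bar>w $ i\<bar> \<le> int k" by linarith
  qed
  obtain N where N: "\<And>n. n \<ge> N \<Longrightarrow>
      real (n ^ CARD('d) - (n - 2 * k) ^ CARD('d)) \<le> e * real n ^ CARD('d)"
    using shell_negligible[OF e] unfolding eventually_sequentially by blast
  show ?thesis
  proof (intro exI[of _ "max N (2 * k)"] allI impI ballI)
    fix n z assume n: "max N (2 * k) \<le> n" and z: "z \<in> topspace Z"
    define P where "P = {v. \<alpha> v z \<in> A}"
    define s where "s = n ^ CARD('d) - (n - 2 * k) ^ CARD('d)"
    have sum_ind: "(\<Sum>v \<in> cube n u. ind Z A (\<alpha> v z)) = int (card (cube n u \<inter> P))" for u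
      using z by (simp add: ind_def P_def indicator_def sum.If_cases finite_cube)
    have "(\<Sum>v \<in> cube n 0. ind Z (\<alpha> w ` A) (\<alpha> v z)) = (\<Sum>v \<in> cube n 0. ind Z A (\<alpha> (v - w) z))"
      using z by (intro sum.cong) (simp_all add: ind_act[OF At] act_add)
    also have "\<dots> = (\<Sum>v \<in> cube n (- w). ind Z A (\<alpha> v z))"
      unfolding cube_uminus by (subst sum.reindex) (auto simp: inj_on_def)
    finally have "(\<Sum>v \<in> cube n 0. h (\<alpha> v z)) =
        int (card (cube n 0 \<inter> P)) - int (card (cube n (- w) \<inter> P))"
      using z by (simp add: h sum_subtractf sum_ind)
    moreover have "card (C \<inter> P) \<le> card (C' \<inter> P) + card (C - C')"
      if "C = cube n u" "C' = cube n u'" for C C' u u'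
    proof -
      have "card (C \<inter> P) \<le> card ((C' \<inter> P) \<union> (C - C'))"
        using that finite_cube by (intro card_mono) auto
      also have "\<dots> \<le> card (C' \<inter> P) + card (C - C')" by (rule card_Un_le)
      finally show ?thesis .
    qed
    from this[OF refl refl, of 0 "- w"] this[OF refl refl, of "- w" 0]
    have "card (cube n 0 \<inter> P) \<le> card (cube n (- w) \<inter> P) + s"
      "card (cube n (- w) \<inter> P) \<le> card (cube n 0 \<inter> P) + s"
      using card_cube_diff[OF w, of n] n unfolding s_def by linarith+
    ultimately have "\<bar>\<Sum>v \<in> cube n 0. h (\<alpha> v z)\<bar> \<le> int s" by linarith
    then have "\<bar>real_of_int (\<Sum>v \<in> cube n 0. h (\<alpha> v z))\<bar> \<le> real s" by linarith
    also have "\<dots> \<le> e * real n ^ CARD('d)" using N[of n] n by (simp add: s_def)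
    finally show "\<bar>real_of_int (\<Sum>v \<in> cube n 0. h (\<alpha> v z))\<bar> \<le> e * real n ^ CARD('d)" .
  qed
qed

text \<open>Induction over the generated subgroup. Each factor of a product gets half of the
  tolerance, so \<open>e\<close> has to vary in the induction.\<close>

lemma sum_coboundary_small:
  assumes "b \<in> coboundaries Z \<alpha>" "e > 0"
  shows "\<exists>N. \<forall>n\<ge>N. \<forall>z \<in> topspace Z.
           \<bar>real_of_int (\<Sum>v \<in> cube n 0. b (\<alpha> v z))\<bar> \<le> e * real n ^ CARD('d)"
  using assms(1)[unfolded coboundaries_def] assms(2)
proof (induction b arbitrary: e rule: generate.induct)
  case one
  then show ?case by (simp add: one_CZ)
next
  case (incl h)
  then show ?case using sum_generator_small by blast
next
  case (inv h)
  from inv(1) obtain A w where h: "clopenin Z A"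
    "h = (\<lambda>x \<in> topspace Z. ind Z A x - ind Z (\<alpha> w ` A) x)" by blast
  then have "h \<in> carrier (CZ Z)" using generator_carrier by simp
  then have "(\<Sum>v \<in> cube n 0. (inv\<^bsub>CZ Z\<^esub> h) (\<alpha> v z)) = - (\<Sum>v \<in> cube n 0. h (\<alpha> v z))"
    if "z \<in> topspace Z" for n z
    using that by (simp add: inv_CZ sum_negf)
  then show ?case using sum_generator_small[OF h inv(2)] by simp
next
  case (eng h1 h2)
  obtain N1 N2 where N: "\<And>n z. n \<ge> N1 \<Longrightarrow> z \<in> topspace Z \<Longrightarrow>
       \<bar>real_of_int (\<Sum>v \<in> cube n 0. h1 (\<alpha> v z))\<bar> \<le> e / 2 * real n ^ CARD('d)"
     "\<And>n z. n \<ge> N2 \<Longrightarrow> z \<in> topspace Z \<Longrightarrow>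
       \<bar>real_of_int (\<Sum>v \<in> cube n 0. h2 (\<alpha> v z))\<bar> \<le> e / 2 * real n ^ CARD('d)"
    using eng.IH(1)[of "e / 2"] eng.IH(2)[of "e / 2"] eng.prems half_gt_zero by metis
  show ?case
  proof (intro exI[of _ "max N1 N2"] allI impI ballI)
    fix n z assume n: "max N1 N2 \<le> n" and z: "z \<in> topspace Z"
    have "(\<Sum>v \<in> cube n 0. (h1 \<otimes>\<^bsub>CZ Z\<^esub> h2) (\<alpha> v z)) =
        (\<Sum>v \<in> cube n 0. h1 (\<alpha> v z)) + (\<Sum>v \<in> cube n 0. h2 (\<alpha> v z))"
      using z by (simp add: mult_CZ sum.distrib)
    then show "\<bar>real_of_int (\<Sum>v \<in> cube n 0. (h1 \<otimes>\<^bsub>CZ Z\<^esub> h2) (\<alpha> v z))\<bar> \<le> e * real n ^ CARD('d)"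
      using N(1)[of n z] N(2)[of n z] n z by (simp add: field_simps)
  qed
qed

text \<open>Every orbit visits the set where \<open>g\<close> is positive within a bounded distance,
  hence in each cube of some side \<open>m\<close>. A cube of side \<open>m * q\<close> splits into
  \<open>q ^ CARD('d)\<close> of these, and each visit counts at least 1 because \<open>g\<close>
  takes integer values.\<close>

lemma sum_positive_large:
  assumes g: "locally_const Z g" "\<And>z. z \<in> topspace Z \<Longrightarrow> g z \<ge> 0"
    and z0: "z0 \<in> topspace Z" "g z0 > (0 :: int)"
  shows "\<exists>m>0. \<forall>q. \<forall>z \<in> topspace Z. int (q ^ CARD('d)) \<le> (\<Sum>v \<in> cube (m * q) 0. g (\<alpha> v z))"
proof -
  define U where "U = {z \<in> topspace Z. g z > 0}"
  have "openin Z U" "U \<noteq> {}"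
    using openin_locally_const[OF g(1), of "\<lambda>t. t > 0"] z0 by (auto simp: U_def)
  from orbit_meets[OF this] obtain k where k: "\<forall>z \<in> topspace Z. \<exists>v \<in> ball0 k. \<alpha> v z \<in> U" ..
  define m where "m = 2 * k + 1"
  have hit: "\<exists>v \<in> cube m u. \<alpha> v z \<in> U" if z: "z \<in> topspace Z" for z u
  proof -
    \<comment> \<open>The centre: the cube of side \<open>2 * k + 1\<close> with lower corner
      \<open>u\<close> is the ball of radius \<open>k\<close> about \<open>c\<close>.\<close>
    define c :: "int ^ 'd" where "c = u + (\<chi> i. int k)"
    obtain v where v: "v \<in> ball0 k" "\<alpha> v (\<alpha> c z) \<in> U" using k act_in[OF z] by blast
    have "u $ i \<le> (v + c) $ i \<and> (v + c) $ i < u $ i + int m" for i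
    proof -
      have "\<bar>v $ i\<bar> \<le> int k" using v(1) by (simp add: ball0_def)
      then show ?thesis by (simp add: c_def m_def abs_le_iff)
    qed
    then have "v + c \<in> cube m u" by (simp add: cube_def)
    then show ?thesis using v(2) act_add[OF z] by auto
  qed
  show ?thesis
  proof (intro exI[of _ m] conjI allI ballI)
    show "m > 0" by (simp add: m_def)
    fix q z assume z: "z \<in> topspace Z"
    have "\<forall>u. \<exists>v. v \<in> cube m (\<chi> i. int m * u $ i) \<and> \<alpha> v z \<in> U" using hit[OF z] by blast
    from choice[OF this] obtain p where
      p: "\<And>u. p u \<in> cube m (\<chi> i. int m * u $ i)" "\<And>u. \<alpha> (p u) z \<in> U" by auto
    have inj: "inj_on p (cube q 0)"
      using p(1) mem_grid_cube[OF \<open>m > 0\<close>] by (metis inj_onI)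
    have sub: "p ` cube q 0 \<subseteq> cube (m * q) 0"
    proof (intro image_subsetI)
      fix u :: "int ^ 'd" assume u: "u \<in> cube q 0"
      have "0 \<le> p u $ i \<and> p u $ i < int (m * q)" for i
      proof -
        have 1: "int m * u $ i \<le> p u $ i" "p u $ i < int m * u $ i + int m"
          using p(1)[of u] by (auto simp: cube_def)
        have 2: "0 \<le> u $ i" "u $ i + 1 \<le> int q" using u unfolding cube_def by (simp, simp add: zless_imp_add1_zle)
        have "0 \<le> int m * u $ i" using 2 by simp
        moreover have "int m * (u $ i + 1) \<le> int m * int q" using 2 by (intro mult_left_mono) auto
        ultimately show ?thesis using 1 by (simp add: algebra_simps)
      qed
      then show "p u \<in> cube (m * q) 0" by (simp add: cube_def)
    qed
    have "int (q ^ CARD('d)) = (\<Sum>v \<in> p ` cube q 0. 1)"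
      by (simp add: card_image[OF inj] card_cube)
    also have "\<dots> \<le> (\<Sum>v \<in> p ` cube q 0. g (\<alpha> v z))"
    proof (rule sum_mono)
      fix v assume "v \<in> p ` cube q 0"
      then have "\<alpha> v z \<in> U" using p(2) by blast
      then show "1 \<le> g (\<alpha> v z)" by (simp add: U_def)
    qed
    also have "\<dots> \<le> (\<Sum>v \<in> cube (m * q) 0. g (\<alpha> v z))"
      using g(2) z by (intro sum_mono2 finite_cube sub) auto
    finally show "int (q ^ CARD('d)) \<le> (\<Sum>v \<in> cube (m * q) 0. g (\<alpha> v z))" .
  qed
qed

lemma cube_counts:
  assumes A: "A \<subseteq> topspace Z" and B: "B \<subseteq> topspace Z"
    and g: "locally_const Z g" "\<And>z. z \<in> topspace Z \<Longrightarrow> g z \<ge> 0"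
    and z0: "z0 \<in> topspace Z" "g z0 > 0"
    and b: "b \<in> coboundaries Z \<alpha>"
    and eq: "\<And>z. z \<in> topspace Z \<Longrightarrow> ind Z B z - ind Z A z = g z + b z"
  shows "\<exists>n. \<forall>z \<in> topspace Z. card {v \<in> cube n 0. \<alpha> v z \<in> A} < card {v \<in> cube n 0. \<alpha> v z \<in> B}"
proof -
  obtain m where m: "m > 0"
    "\<And>q z. z \<in> topspace Z \<Longrightarrow> int (q ^ CARD('d)) \<le> (\<Sum>v \<in> cube (m * q) 0. g (\<alpha> v z))"
    using sum_positive_large[OF g z0] by metis
  \<comment> \<open>On cubes of side \<open>m * q\<close> this tolerance allows the coboundary half
    of \<open>q ^ CARD('d)\<close>, the lower bound for the sum of \<open>g\<close>.\<close>
  define e where "e = 1 / (2 * real m ^ CARD('d))"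
  have "e > 0" using m(1) by (simp add: e_def)
  from sum_coboundary_small[OF b this] obtain N where N: "\<And>n z. n \<ge> N \<Longrightarrow> z \<in> topspace Z \<Longrightarrow>
      \<bar>real_of_int (\<Sum>v \<in> cube n 0. b (\<alpha> v z))\<bar> \<le> e * real n ^ CARD('d)" by metis
  \<comment> \<open>The successor keeps \<open>q\<close> positive, so that half of its power is
    strictly smaller than the power.\<close>
  define q where "q = Suc N"
  show ?thesis
  proof (intro exI[of _ "m * q"] ballI)
    fix z assume z: "z \<in> topspace Z"
    have count: "(\<Sum>v \<in> cube n 0. ind Z C (\<alpha> v z)) = int (card {v \<in> cube n 0. \<alpha> v z \<in> C})" for n C
      using z by (simp add: ind_def indicator_def sum.If_cases finite_cube Int_def)
    have "m * q \<ge> N" using m(1) by (simp add: q_def Suc_le_eq trans_le_add2)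
    from N[OF this z] have "\<bar>real_of_int (\<Sum>v \<in> cube (m * q) 0. b (\<alpha> v z))\<bar> \<le> real q ^ CARD('d) / 2"
      using m(1) by (simp add: e_def power_mult_distrib)
    also have "\<dots> < real q ^ CARD('d)" by (simp add: q_def)
    finally have "\<bar>real_of_int (\<Sum>v \<in> cube (m * q) 0. b (\<alpha> v z))\<bar> < real_of_int (int (q ^ CARD('d)))"
      by simp
    then have "- (\<Sum>v \<in> cube (m * q) 0. b (\<alpha> v z)) < int (q ^ CARD('d))" by linarith
    also have "\<dots> \<le> (\<Sum>v \<in> cube (m * q) 0. g (\<alpha> v z))" by (rule m(2)[OF z])
    finally have "0 < (\<Sum>v \<in> cube (m * q) 0. g (\<alpha> v z) + b (\<alpha> v z))"
      by (simp add: sum.distrib)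
    also have "\<dots> = (\<Sum>v \<in> cube (m * q) 0. ind Z B (\<alpha> v z) - ind Z A (\<alpha> v z))"
      using z by (intro sum.cong) (simp_all add: eq)
    finally show "card {v \<in> cube (m * q) 0. \<alpha> v z \<in> A} < card {v \<in> cube (m * q) 0. \<alpha> v z \<in> B}"
      by (simp add: sum_subtractf count)
  qed
qed

end

section \<open>The induced homomorphism\<close>

text \<open>The second factor is discrete, so the product splits into open slices. Boundedness of an
  orbit injection thus becomes local constancy of the cocycle for each fixed
  \<open>w\<close>.\<close>

lemma continuous_map_discrete_prod_iff:
  fixes f :: "'a \<Rightarrow> 'b \<Rightarrow> 'c"
  shows "continuous_map (prod_topology X (discrete_topology UNIV)) (discrete_topology UNIV)
      (\<lambda>(x, w). f x w) \<longleftrightarrow> (\<forall>w. locally_const X (\<lambda>x. f x w))"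
proof
  assume L: "locally_const (prod_topology X (discrete_topology UNIV)) (\<lambda>(x, w). f x w)"
  show "\<forall>w. locally_const X (\<lambda>x. f x w)"
  proof
    fix w :: 'b
    have "continuous_map X (prod_topology X (discrete_topology UNIV)) (\<lambda>x. (x, w))"
      by (intro continuous_map_pairedI continuous_map_const[THEN iffD2])
         (simp_all add: continuous_map_id[unfolded id_def])
    from continuous_map_compose[OF this L] show "locally_const X (\<lambda>x. f x w)"
      by (simp add: o_def)
  qed
next
  assume R: "\<forall>w. locally_const X (\<lambda>x. f x w)"
  show "locally_const (prod_topology X (discrete_topology UNIV)) (\<lambda>(x, w). f x w)"
    unfolding locally_const_iff
  proof (intro ballI, clarsimp)
    fix x and w :: 'b assume "x \<in> topspace X"
    with R obtain U where U: "openin X U" "x \<in> U" "\<forall>y\<in>U. f x w = f y w"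
      unfolding locally_const_iff by metis
    have "openin (prod_topology X (discrete_topology UNIV)) (U \<times> {w})"
      using U(1) by (simp add: openin_prod_Times_iff)
    moreover have "f x w = (case y of (x, w) \<Rightarrow> f x w)" if y: "y \<in> U \<times> {w}" for y
    proof -
      obtain u where u: "u \<in> U" "y = (u, w)" using y by blast
      show ?thesis using bspec[OF U(3) u(1)] u(2) by simp
    qed
    ultimately show "\<exists>V. openin (prod_topology X (discrete_topology UNIV)) V \<and> (x, w) \<in> V \<and>
        (\<forall>y\<in>V. f x w = (case y of (x, w) \<Rightarrow> f x w))"
      using U(2) by (intro exI[of _ "U \<times> {w}"] conjI ballI) auto
  qed
qed

context fmc_system
begin

text \<open>Induction on the number of nonzero values.\<close>

lemma CZ_induct [consumes 1, case_names one mult inverse ind]: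
  assumes f: "f \<in> carrier (CZ Z)"
    and one: "P \<one>\<^bsub>CZ Z\<^esub>"
    and mult: "\<And>f g. f \<in> carrier (CZ Z) \<Longrightarrow> g \<in> carrier (CZ Z) \<Longrightarrow> P f \<Longrightarrow> P g \<Longrightarrow> P (f \<otimes>\<^bsub>CZ Z\<^esub> g)"
    and inverse: "\<And>f. f \<in> carrier (CZ Z) \<Longrightarrow> P f \<Longrightarrow> P (inv\<^bsub>CZ Z\<^esub> f)"
    and ind: "\<And>A. clopenin Z A \<Longrightarrow> P (ind Z A)"
  shows "P f"
proof -
  let ?m = "\<lambda>A k. \<lambda>x \<in> topspace Z. k * ind Z A x"
  have m: "?m A k \<in> carrier (CZ Z)" if "clopenin Z A" for A and k :: int
    by (rule restrict_carrier_CZ, rule locally_const_dep[of _ "ind Z A"])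
       (use ind_carrier[OF that] in \<open>auto simp: carrier_CZ\<close>)
  have pos: "P (?m A (int k))" if A: "clopenin Z A" for A k
  proof (induction k)
    case 0
    show ?case using one by (simp only: one_CZ of_nat_0 mult_zero_left)
  next
    case (Suc k)
    have eq: "?m A (int (Suc k)) = ?m A (int k) \<otimes>\<^bsub>CZ Z\<^esub> ind Z A"
      unfolding mult_CZ by (intro restrict_ext) (simp add: algebra_simps)
    show ?case unfolding eq by (rule mult[OF m[OF A] ind_carrier[OF A] Suc ind[OF A]])
  qed
  have all: "P (?m A k)" if A: "clopenin Z A" for A k
  proof (cases "k \<ge> 0")
    case True
    then show ?thesis using pos[OF A, of "nat k"] by simp
  next
    case False
    then have eq: "?m A k = inv\<^bsub>CZ Z\<^esub> (?m A (int (nat (- k))))"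
      unfolding inv_CZ[OF m[OF A]] by (intro restrict_ext) simp
    show ?thesis unfolding eq by (rule inverse[OF m[OF A] pos[OF A]])
  qed
  have fin: "finite (f ` topspace Z - {0})" if "f \<in> carrier (CZ Z)" for f
    using finite_range[of f] that by (simp add: carrier_CZ)
  show ?thesis
    using f
  proof (induction "card (f ` topspace Z - {0})" arbitrary: f rule: less_induct)
    case less
    show ?case
    proof (cases "f ` topspace Z - {0} = {}")
      case True
      then have "f = \<one>\<^bsub>CZ Z\<^esub>"
        using less.prems by (auto simp: one_CZ carrier_CZ extensional_def fun_eq_iff)
      then show ?thesis using one by simp
    next
      case False
      then obtain c where c: "c \<in> f ` topspace Z" "c \<noteq> 0" by blast
      define A where "A = {x \<in> topspace Z. f x = c}"
      have lcf: "locally_const Z f" using less.prems by (simp add: carrier_CZ)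
      then have A: "clopenin Z A" unfolding A_def by (rule clopenin_level[of _ f "\<lambda>t. t = c"])
      \<comment> \<open>Replacing the value \<open>c\<close> by 0 leaves one nonzero value fewer,
        and \<open>f\<close> is \<open>c\<close> times the indicator of \<open>A\<close> plus
        \<open>f'\<close>.\<close>
      define f' where "f' = (\<lambda>x \<in> topspace Z. if f x = c then 0 else f x)"
      have f': "f' \<in> carrier (CZ Z)"
        unfolding f'_def by (rule restrict_carrier_CZ, rule locally_const_dep[OF lcf]) simp
      have "f' ` topspace Z - {0} \<subset> f ` topspace Z - {0}"
      proof (rule psubsetI)
        show "f' ` topspace Z - {0} \<subseteq> f ` topspace Z - {0}" by (auto simp: f'_def)
        have "c \<notin> f' ` topspace Z" using c(2) by (auto simp: f'_def)
        then show "f' ` topspace Z - {0} \<noteq> f ` topspace Z - {0}" using c by blast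
      qed
      then have "P f'" using less.hyps[OF psubset_card_mono[OF fin[OF less.prems]] f'] by blast
      moreover have "f = ?m A c \<otimes>\<^bsub>CZ Z\<^esub> f'"
        using less.prems
        by (auto simp: mult_CZ f'_def A_def ind_def indicator_def carrier_CZ extensional_def fun_eq_iff)
      ultimately show ?thesis using mult[OF m[OF A] f' all[OF A]] by simp
    qed
  qed
qed

end

section \<open>Transport of functions along a bounded orbit injection\<close>

locale bounded_injection = X: fmc_system X \<phi> + Z: fmc_system Z \<alpha>
  for X :: "'a topology" and \<phi> :: "int ^ 'd \<Rightarrow> 'a \<Rightarrow> 'a"
    and Z :: "'c topology" and \<alpha> :: "int ^ 'd \<Rightarrow> 'c \<Rightarrow> 'c" +
  fixes \<theta> :: "'a \<Rightarrow> 'c"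
  assumes boi: "bounded_orbit_injection X \<phi> Z \<alpha> \<theta>"
begin

lemma inj_continuous: "continuous_map X Z \<theta>" and inj_open_map: "open_map X Z \<theta>"
  and inj: "inj_on \<theta> (topspace X)"
  using boi by (simp_all add: bounded_orbit_injection_def orbit_injection_def)

lemma orbit_iff:
  "x \<in> topspace X \<Longrightarrow> y \<in> topspace X \<Longrightarrow> (\<exists>w. \<phi> w x = y) \<longleftrightarrow> (\<exists>v. \<alpha> v (\<theta> x) = \<theta> y)"
  using boi unfolding bounded_orbit_injection_def orbit_injection_def by blast

lemma inj_in [simp]: "x \<in> topspace X \<Longrightarrow> \<theta> x \<in> topspace Z"
  using continuous_map_image_subset_topspace[OF inj_continuous] by blast

lemma inj_eq [simp]: "x \<in> topspace X \<Longrightarrow> y \<in> topspace X \<Longrightarrow> \<theta> x = \<theta> y \<longleftrightarrow> x = y"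
  using inj by (simp add: inj_on_eq_iff)

lemma openin_inj_image: "openin X U \<Longrightarrow> openin Z (\<theta> ` U)"
  using inj_open_map by (simp add: open_map_def)

text \<open>Closedness holds because the image is compact in a Hausdorff space.\<close>

lemma clopenin_inj_image:
  assumes "clopenin X A"
  shows "clopenin Z (\<theta> ` A)"
proof -
  have "compactin X A" using assms X.compact by (simp add: clopenin_def closedin_compact_space)
  then have "compactin Z (\<theta> ` A)" by (rule image_compactin[OF _ inj_continuous])
  then have "closedin Z (\<theta> ` A)"
    using Hausdorff_cantor_space[OF Z.cantor] by (rule compactin_imp_closedin[rotated])
  then show ?thesis using assms openin_inj_image by (simp add: clopenin_def)
qed

abbreviation \<eta> :: "'a \<Rightarrow> int ^ 'd \<Rightarrow> int ^ 'd" where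
  "\<eta> \<equiv> cocycle \<phi> \<alpha> \<theta>"

lemma cocycle_eq: "x \<in> topspace X \<Longrightarrow> \<alpha> (\<eta> x w) (\<theta> x) = \<theta> (\<phi> w x)"
proof -
  assume x: "x \<in> topspace X"
  obtain v where v: "\<alpha> v (\<theta> x) = \<theta> (\<phi> w x)"
    using orbit_iff[OF x X.act_in[OF x], of w] by blast
  have "\<alpha> (THE v. \<alpha> v (\<theta> x) = \<theta> (\<phi> w x)) (\<theta> x) = \<theta> (\<phi> w x)"
    by (rule theI[of _ v], rule v) (use v x Z.act_eq_iff in \<open>metis inj_in\<close>)
  then show ?thesis by (simp add: cocycle_def)
qed

lemma cocycle_locally_const: "locally_const X (\<lambda>x. \<eta> x w)"
  using boi unfolding bounded_orbit_injection_def continuous_map_discrete_prod_iff by blast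

text \<open>Composition with the inverse of \<open>\<theta>\<close>, extended by zero. Indicators go
  to indicators of images, so the map induced on classes is the one that \<open>induced_hom\<close>
  describes.\<close>

definition push :: "('a \<Rightarrow> int) \<Rightarrow> 'c \<Rightarrow> int" where
  "push f = (\<lambda>z \<in> topspace Z. if z \<in> \<theta> ` topspace X then f (inv_into (topspace X) \<theta> z) else 0)"

lemma push_inj: "x \<in> topspace X \<Longrightarrow> push f (\<theta> x) = f x"
  by (simp add: push_def inj)

lemma push_outside: "z \<in> topspace Z \<Longrightarrow> z \<notin> \<theta> ` topspace X \<Longrightarrow> push f z = 0"
  by (simp add: push_def)

lemma push_eqI:
  assumes "g \<in> extensional (topspace Z)" "\<And>x. x \<in> topspace X \<Longrightarrow> g (\<theta> x) = f x"
    and "\<And>z. z \<in> topspace Z \<Longrightarrow> z \<notin> \<theta> ` topspace X \<Longrightarrow> g z = 0"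
  shows "push f = g"
proof (rule extensionalityI[of _ "topspace Z"])
  fix z assume z: "z \<in> topspace Z"
  show "push f z = g z"
  proof (cases "z \<in> \<theta> ` topspace X")
    case True
    then show ?thesis using assms(2) push_inj by auto
  next
    case False
    then show ?thesis using assms(3)[OF z] push_outside[OF z] by simp
  qed
qed (simp_all add: push_def assms(1))

text \<open>The image of \<open>X\<close> is clopen. Near its points local constancy is inherited
  through the open map \<open>\<theta>\<close>; on its complement \<open>push f\<close> is
  0.\<close>

lemma push_carrier:
  assumes "f \<in> carrier (CZ X)"
  shows "push f \<in> carrier (CZ Z)"
proof -
  have lcf: "locally_const X f" using assms by (simp add: carrier_CZ)
  have "locally_const Z (push f)"
    unfolding locally_const_iff
  proof
    fix z assume z: "z \<in> topspace Z"
    show "\<exists>U. openin Z U \<and> z \<in> U \<and> (\<forall>y\<in>U. push f z = push f y)"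
    proof (cases "z \<in> \<theta> ` topspace X")
      case True
      then obtain x where x: "x \<in> topspace X" "z = \<theta> x" by blast
      from bspec[OF lcf[unfolded locally_const_iff] x(1)]
      obtain U where U: "openin X U" "x \<in> U" "\<forall>y\<in>U. f x = f y" by (elim exE conjE)
      have "push f z = push f y" if y: "y \<in> \<theta> ` U" for y
      proof -
        obtain u where u: "u \<in> U" "y = \<theta> u" using y by blast
        then have "u \<in> topspace X" using openin_subset[OF U(1)] by blast
        then show ?thesis using bspec[OF U(3) u(1)] u(2) x by (simp add: push_inj)
      qed
      then show ?thesis using openin_inj_image[OF U(1)] U(2) x(2) by blast
    next
      case False
      have "clopenin X (topspace X)" by (simp add: clopenin_def)
      then have "openin Z (topspace Z - \<theta> ` topspace X)"
        using clopenin_inj_image by (auto simp: clopenin_def)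
      moreover have "push f z = push f y" if "y \<in> topspace Z - \<theta> ` topspace X" for y
        using that z False by (simp add: push_outside)
      ultimately show ?thesis using z False by blast
    qed
  qed
  then show ?thesis by (simp add: carrier_CZ push_def)
qed

lemma push_mult: "push (f \<otimes>\<^bsub>CZ X\<^esub> g) = push f \<otimes>\<^bsub>CZ Z\<^esub> push g"
  by (rule push_eqI) (simp_all add: mult_CZ push_inj push_outside)

lemma push_hom: "push \<in> hom (CZ X) (CZ Z)"
  by (simp add: hom_def push_carrier push_mult)

lemma push_ind: "A \<subseteq> topspace X \<Longrightarrow> push (ind X A) = ind Z (\<theta> ` A)"
  by (rule push_eqI) (auto simp: ind_def indicator_def inj_on_image_mem_iff[OF inj])

text \<open>On the finitely many pieces of \<open>A\<close> where the cocycle \<open>\<eta> _ v\<close> is constant, the translation by \<open>v\<close>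
  becomes a translation in the target.\<close>

lemma push_generator:
  assumes A: "clopenin X A"
  shows "push (\<lambda>x \<in> topspace X. ind X A x - ind X (\<phi> v ` A) x) \<in> coboundaries Z \<alpha>"
proof -
  have At: "A \<subseteq> topspace X" and lcA: "locally_const X (\<lambda>x. x \<in> A)"
    using A by (simp_all add: clopenin_iff)
  define D where "D w = {x \<in> A. \<eta> x v = w}" for w
  have D: "clopenin X (D w)" for w
  proof -
    have "locally_const X (\<lambda>x. x \<in> D w)"
      by (rule locally_const_dep2[OF lcA cocycle_locally_const[of v]]) (simp add: D_def)
    then show ?thesis using At by (auto simp: clopenin_iff D_def)
  qed
  define g where "g w = (\<lambda>z \<in> topspace Z. ind Z (\<theta> ` D w) z - ind Z (\<alpha> w ` \<theta> ` D w) z)" for w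
  have g: "g w \<in> coboundaries Z \<alpha>" for w
    unfolding coboundaries_def g_def
    by (rule generate.incl) (use clopenin_inj_image[OF D] in blast)
  have sums: "(\<lambda>z \<in> topspace Z. \<Sum>w\<in>S. g w z) \<in> coboundaries Z \<alpha>" if "finite S" for S
    using that
  proof (induction S)
    case empty
    show ?case using subgroup.one_closed[OF Z.subgroup_coboundaries] by (simp only: one_CZ sum.empty)
  next
    case (insert w S)
    have eq: "(\<lambda>z \<in> topspace Z. \<Sum>w\<in>insert w S. g w z) =
        g w \<otimes>\<^bsub>CZ Z\<^esub> (\<lambda>z \<in> topspace Z. \<Sum>w\<in>S. g w z)"
      unfolding mult_CZ using insert.hyps by (intro restrict_ext) simp
    show ?case unfolding eq by (rule subgroup.m_closed[OF Z.subgroup_coboundaries g insert.IH])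
  qed
  define S where "S = (\<lambda>x. \<eta> x v) ` topspace X"
  have S: "finite S" unfolding S_def by (rule X.finite_range[OF cocycle_locally_const])
  \<comment> \<open>On \<open>D w\<close> the cocycle equals \<open>w\<close>, so
    \<open>\<alpha> w\<close> after \<open>\<theta>\<close> is \<open>\<theta>\<close> after
    \<open>\<phi> v\<close>.\<close>
  have im: "\<alpha> w ` \<theta> ` D w = (\<lambda>x. \<theta> (\<phi> v x)) ` D w" for w
    unfolding image_image using At by (intro image_cong) (auto simp: D_def cocycle_eq[symmetric])
  \<comment> \<open>The sets \<open>D w\<close> partition \<open>A\<close>. This is used for
    \<open>\<theta>\<close> and for \<open>\<theta>\<close> after \<open>\<phi> v\<close>, the two
    terms of the generator.\<close>
  have pieces: "(\<Sum>w\<in>S. ind Z (p ` D w) z) = ind Z (p ` A) z"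
    if p: "inj_on p (topspace X)" and z: "z \<in> topspace Z" for p z
  proof (cases "z \<in> p ` A")
    case True
    then obtain x where x: "x \<in> A" "z = p x" by blast
    have "z \<in> p ` D w \<longleftrightarrow> w = \<eta> x v" for w
      using x At p by (auto simp: D_def inj_on_def)
    then have "(\<Sum>w\<in>S. ind Z (p ` D w) z) = (\<Sum>w\<in>S. if w = \<eta> x v then 1 else 0)"
      using z by (intro sum.cong) (simp_all add: ind_def indicator_def)
    also have "\<dots> = 1" using S x At by (auto simp: S_def)
    finally show ?thesis using True z by (simp add: ind_def)
  next
    case False
    then have "z \<notin> p ` D w" for w by (auto simp: D_def)
    then show ?thesis using False z by (simp add: ind_def)
  qed
  have inj2: "inj_on (\<lambda>x. \<theta> (\<phi> v x)) (topspace X)"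
    using homeomorphic_imp_injective_map[OF X.homeo[of v]] by (auto simp: inj_on_def)
  have "push (\<lambda>x \<in> topspace X. ind X A x - ind X (\<phi> v ` A) x) = (\<lambda>z \<in> topspace Z. \<Sum>w\<in>S. g w z)"
  proof -
    have "(\<Sum>w\<in>S. g w z) = push (ind X A) z - push (ind X (\<phi> v ` A)) z" if z: "z \<in> topspace Z" for z
    proof -
      have "\<phi> v ` A \<subseteq> topspace X" using At by auto
      then have "push (ind X (\<phi> v ` A)) z = ind Z ((\<lambda>x. \<theta> (\<phi> v x)) ` A) z"
        by (simp add: push_ind image_image)
      then show ?thesis
        using z At by (simp add: g_def sum_subtractf im pieces[OF inj] pieces[OF inj2] push_ind)
    qed
    then show ?thesis by (intro push_eqI) (simp_all add: push_inj push_outside)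
  qed
  then show ?thesis using sums[OF S] by simp
qed

lemma push_coboundary:
  assumes "b \<in> coboundaries X \<phi>"
  shows "push b \<in> coboundaries Z \<alpha>"
proof -
  interpret push: group_hom "CZ X" "CZ Z" push
    by (intro group_hom.intro group_hom_axioms.intro CZ.is_group push_hom)
  show ?thesis
    using assms[unfolded coboundaries_def]
  proof (induction rule: generate.induct)
    case one
    then show ?case using subgroup.one_closed[OF Z.subgroup_coboundaries] push.hom_one by simp
  next
    case (incl h)
    then show ?case using push_generator by blast
  next
    case (inv h)
    then obtain A v where h: "clopenin X A"
      "h = (\<lambda>x \<in> topspace X. ind X A x - ind X (\<phi> v ` A) x)" by blast
    then have "push (inv\<^bsub>CZ X\<^esub> h) = inv\<^bsub>CZ Z\<^esub> push h"
      using X.generator_carrier push.hom_inv by simp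
    then show ?case
      using subgroup.m_inv_closed[OF Z.subgroup_coboundaries push_generator[OF h(1), of v]] h(2) by simp
  next
    case (eng h1 h2)
    then show ?case using subgroup.m_closed[OF Z.subgroup_coboundaries] by (simp add: push_mult)
  qed
qed

text \<open>The description behind \<open>induced_hom\<close> must have exactly one solution.
  Existence: \<open>push\<close> preserves coboundaries, so it factors through the quotient.
  Uniqueness: by \<open>CZ_induct\<close> a homomorphism is determined by the classes of indicators,
  and \<open>extensional\<close> fixes it off the carrier.\<close>

lemma induced_hom_ind:
  assumes "clopenin X A"
  shows "induced_hom X \<phi> Z \<alpha> \<theta> (cls X \<phi> (ind X A)) = cls Z \<alpha> (ind Z (\<theta> ` A))"
proof -
  let ?P = "\<lambda>h. h \<in> hom (GZ X \<phi>) (GZ Z \<alpha>) \<and> h \<in> extensional (carrier (GZ X \<phi>)) \<and>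
        (\<forall>A. clopenin X A \<longrightarrow> h (cls X \<phi> (ind X A)) = cls Z \<alpha> (ind Z (\<theta> ` A)))"
  interpret GX: group "GZ X \<phi>" by (rule X.group_GZ)
  interpret GZ: group "GZ Z \<alpha>" by (rule Z.group_GZ)
  have carr: "carrier (GZ X \<phi>) = cls X \<phi> ` carrier (CZ X)"
    by (simp add: GZ_def carrier_FactGroup cls_def[abs_def])
  have clsc: "f \<in> carrier (CZ X) \<Longrightarrow> cls X \<phi> f \<in> carrier (GZ X \<phi>)" for f by (simp add: carr)
  have hom0: "(\<lambda>f. cls Z \<alpha> (push f)) \<in> hom (CZ X) (GZ Z \<alpha>)"
    using hom_compose[OF push_hom Z.cls_hom] by (simp add: o_def)
  obtain g where g: "g \<in> hom (GZ X \<phi>) (GZ Z \<alpha>)"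
    "\<And>f. f \<in> carrier (CZ X) \<Longrightarrow> g (cls X \<phi> f) = cls Z \<alpha> (push f)"
  proof (rule FactGroup_universal[OF hom0 X.normal_coboundaries])
    fix f f' assume f: "f \<in> carrier (CZ X)" "f' \<in> carrier (CZ X)"
      and eq: "coboundaries X \<phi> #>\<^bsub>CZ X\<^esub> f = coboundaries X \<phi> #>\<^bsub>CZ X\<^esub> f'"
    then have "(\<lambda>x \<in> topspace X. f x - f' x) \<in> coboundaries X \<phi>"
      using X.cls_eq_iff[OF f] by (simp add: cls_def)
    from push_coboundary[OF this]
    have "push (\<lambda>x \<in> topspace X. f x - f' x) \<in> coboundaries Z \<alpha>" .
    moreover have "push (\<lambda>x \<in> topspace X. f x - f' x) = (\<lambda>z \<in> topspace Z. push f z - push f' z)"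
      by (rule push_eqI) (simp_all add: push_inj push_outside)
    ultimately show "cls Z \<alpha> (push f) = cls Z \<alpha> (push f')"
      using Z.cls_eq_iff[OF push_carrier push_carrier] f by simp
  qed (simp add: GZ_def cls_def)
  define h where "h = restrict g (carrier (GZ X \<phi>))"
  have "h \<in> hom (GZ X \<phi>) (GZ Z \<alpha>)"
    using g(1) GX.m_closed by (auto simp: h_def hom_def)
  moreover have "h (cls X \<phi> (ind X A)) = cls Z \<alpha> (ind Z (\<theta> ` A))" if A: "clopenin X A" for A
  proof -
    have "A \<subseteq> topspace X" using A by (simp add: clopenin_iff)
    then show ?thesis using ind_carrier[OF A] by (simp add: h_def clsc g(2) push_ind)
  qed
  ultimately have Ph: "?P h" by (simp add: h_def)
  have uniq: "h1 = h2" if P: "?P h1" "?P h2" for h1 h2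
  proof (rule extensionalityI[of _ "carrier (GZ X \<phi>)"])
    interpret h1: group_hom "CZ X" "GZ Z \<alpha>" "\<lambda>f. h1 (cls X \<phi> f)"
      using hom_compose[OF X.cls_hom conjunct1[OF P(1)]]
      by (intro group_hom.intro group_hom_axioms.intro CZ.is_group Z.group_GZ) (simp add: o_def)
    interpret h2: group_hom "CZ X" "GZ Z \<alpha>" "\<lambda>f. h2 (cls X \<phi> f)"
      using hom_compose[OF X.cls_hom conjunct1[OF P(2)]]
      by (intro group_hom.intro group_hom_axioms.intro CZ.is_group Z.group_GZ) (simp add: o_def)
    have "h1 (cls X \<phi> f) = h2 (cls X \<phi> f)" if "f \<in> carrier (CZ X)" for f
      using that
    proof (induction rule: X.CZ_induct)
      case one
      show ?case using h1.hom_one h2.hom_one by simp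
    next
      case (mult f g)
      then show ?case using h1.hom_mult[of f g] h2.hom_mult[of f g] by simp
    next
      case (inverse f)
      then show ?case using h1.hom_inv[of f] h2.hom_inv[of f] by simp
    next
      case (ind A)
      then show ?case using P by simp
    qed
    then show "h1 c = h2 c" if "c \<in> carrier (GZ X \<phi>)" for c using that by (auto simp: carr)
  qed (use P in auto)
  have "?P (THE h. ?P h)" by (rule theI[of ?P h]) (use Ph uniq in blast)+
  then show ?thesis using assms by (simp add: induced_hom_def)
qed

end

section \<open>Comparison\<close>

text \<open>The order relation yields a nonnegative \<open>g\<close> and a coboundary
  \<open>b\<close> that add up to the difference of the two indicators; strictness makes
  \<open>g\<close> nonzero. Then \<open>cube_counts\<close> supplies the hypothesis of
  \<open>total_dmatching\<close>.\<close>

lemma (in fmc_system) comparison: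
  assumes A: "clopenin Z A" and B: "clopenin Z B"
    and less: "GZ_less Z \<alpha> (cls Z \<alpha> (ind Z A)) (cls Z \<alpha> (ind Z B))"
  shows "\<exists>n \<delta>. dmatching A B n \<delta> \<and> (\<forall>z\<in>A. \<delta> z \<noteq> None)"
proof -
  note indA = ind_carrier[OF A] and indB = ind_carrier[OF B]
  define f where "f = (\<lambda>z \<in> topspace Z. ind Z B z - ind Z A z)"
  have f: "f \<in> carrier (CZ Z)" and diff: "ind Z B \<otimes>\<^bsub>CZ Z\<^esub> inv\<^bsub>CZ Z\<^esub> ind Z A = f"
    using diff_CZ[OF indB indA] CZ.m_closed[OF indB CZ.inv_closed[OF indA]] by (simp_all add: f_def)
  have "cls Z \<alpha> f \<in> GZ_pos Z \<alpha>"
    using less unfolding GZ_less_def GZ_le_def cls_inv[OF indA] cls_mult[OF indB CZ.inv_closed[OF indA]]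
      diff by simp
  then obtain g where g: "g \<in> carrier (CZ Z)" "\<forall>z \<in> topspace Z. 0 \<le> g z" "cls Z \<alpha> f = cls Z \<alpha> g"
    unfolding GZ_pos_def by blast
  define b where "b = (\<lambda>z \<in> topspace Z. f z - g z)"
  have b: "b \<in> coboundaries Z \<alpha>" using g(3) cls_eq_iff[OF f g(1)] by (simp add: b_def)
  \<comment> \<open>If \<open>g\<close> vanished, \<open>f\<close> would be a coboundary and the two
    classes would agree.\<close>
  have "\<exists>z0 \<in> topspace Z. g z0 \<noteq> 0"
  proof (rule ccontr)
    assume "\<not> ?thesis"
    then have "b = f" unfolding b_def f_def by (intro restrict_ext) simp
    then have "cls Z \<alpha> (ind Z B) = cls Z \<alpha> (ind Z A)"
      using b cls_eq_iff[OF indB indA] by (simp add: f_def)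
    then show False using less by (simp add: GZ_less_def)
  qed
  then obtain z0 where z0: "z0 \<in> topspace Z" "g z0 > 0" using g(2) by (metis order_le_less)
  have "\<exists>n. \<forall>z \<in> topspace Z. card {v \<in> cube n 0. \<alpha> v z \<in> A} < card {v \<in> cube n 0. \<alpha> v z \<in> B}"
  proof (rule cube_counts[where g = g and b = b])
    fix z assume "z \<in> topspace Z"
    then show "ind Z B z - ind Z A z = g z + b z" by (simp add: b_def f_def)
  qed (use A B g z0 b in \<open>auto simp: clopenin_iff carrier_CZ\<close>)
  then obtain n where
    "\<And>z. z \<in> topspace Z \<Longrightarrow> card {v \<in> cube n 0. \<alpha> v z \<in> A} < card {v \<in> cube n 0. \<alpha> v z \<in> B}"
    by blast
  from total_dmatching[OF this A B] show ?thesis by blast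
qed

text \<open>Where \<open>\<sigma>\<close> is constant, \<open>\<theta>2\<close> after
  \<open>\<theta>\<close> is \<open>\<theta>1\<close> followed by a single homeomorphism, so
  continuity and openness carry over. Displacement along orbits preserves the orbit relation, and
  the new cocycle is locally determined by the two old ones and \<open>\<sigma>\<close>.\<close>

lemma bounded_orbit_injection_lift:
  assumes T1: "bounded_injection X \<phi> Z \<alpha> \<theta>1" and T2: "bounded_injection Y \<psi> Z \<alpha> \<theta>2"
    and \<sigma>: "locally_const X \<sigma>"
    and \<theta>: "\<And>x. x \<in> topspace X \<Longrightarrow> \<theta> x \<in> topspace Y"
      "\<And>x. x \<in> topspace X \<Longrightarrow> \<theta>2 (\<theta> x) = \<alpha> (\<sigma> x) (\<theta>1 x)"
    and inj: "\<And>x y. x \<in> topspace X \<Longrightarrow> y \<in> topspace X \<Longrightarrow>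
      \<alpha> (\<sigma> x) (\<theta>1 x) = \<alpha> (\<sigma> y) (\<theta>1 y) \<Longrightarrow> x = y"
  shows "bounded_orbit_injection X \<phi> Y \<psi> \<theta>"
proof -
  interpret T1: bounded_injection X \<phi> Z \<alpha> \<theta>1 by (rule T1)
  interpret T2: bounded_injection Y \<psi> Z \<alpha> \<theta>2 by (rule T2)
  have cont1: "continuous_map X Z (\<lambda>x. \<alpha> w (\<theta>1 x))" for w
    using continuous_map_compose[OF T1.inj_continuous homeomorphic_imp_continuous_map[OF T1.Z.homeo]]
    by (simp add: o_def)
  have cont: "continuous_map X Y \<theta>"
    unfolding continuous_map
  proof (intro conjI allI impI)
    show "\<theta> ` topspace X \<subseteq> topspace Y" using \<theta>(1) by blast
    fix V assume V: "openin Y V"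
    have mem: "\<theta> x \<in> V \<longleftrightarrow> \<alpha> (\<sigma> x) (\<theta>1 x) \<in> \<theta>2 ` V" if x: "x \<in> topspace X" for x
      unfolding \<theta>(2)[OF x, symmetric]
      by (rule inj_on_image_mem_iff[OF T2.inj \<theta>(1)[OF x] openin_subset[OF V], symmetric])
    show "openin X {x \<in> topspace X. \<theta> x \<in> V}"
    proof (subst openin_subopen, intro ballI)
      fix x assume x: "x \<in> {x \<in> topspace X. \<theta> x \<in> V}"
      \<comment> \<open>The displacement is frozen at \<open>\<sigma> x\<close>, so that membership
        in the image of \<open>V\<close> is tested through one continuous map.\<close>
      define U where "U = {y \<in> topspace X. \<sigma> y = \<sigma> x} \<inter> {y \<in> topspace X. \<alpha> (\<sigma> x) (\<theta>1 y) \<in> \<theta>2 ` V}"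
      have "openin X U" unfolding U_def
        by (intro openin_Int openin_locally_const[OF \<sigma>, of "\<lambda>t. t = \<sigma> x"]
            openin_continuous_map_preimage[OF cont1 T2.openin_inj_image[OF V]])
      moreover have "x \<in> U" using x mem[of x] by (simp add: U_def)
      moreover have "U \<subseteq> {x \<in> topspace X. \<theta> x \<in> V}"
      proof
        fix y assume "y \<in> U"
        then have "y \<in> topspace X" "\<alpha> (\<sigma> y) (\<theta>1 y) \<in> \<theta>2 ` V" by (simp_all add: U_def)
        then show "y \<in> {x \<in> topspace X. \<theta> x \<in> V}" using mem by simp
      qed
      ultimately show "\<exists>U. openin X U \<and> x \<in> U \<and> U \<subseteq> {x \<in> topspace X. \<theta> x \<in> V}" by blast
    qed
  qed
  have openm: "open_map X Y \<theta>"
    unfolding open_map_def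
  proof (intro allI impI)
    fix U assume U: "openin X U"
    then have Ut: "U \<subseteq> topspace X" by (rule openin_subset)
    \<comment> \<open>The image of \<open>U\<close> under \<open>\<theta>2\<close> after
      \<open>\<theta>\<close>, split by the values of \<open>\<sigma>\<close> so that every piece is
      visibly open.\<close>
    define W where "W = (\<Union>w. \<alpha> w ` \<theta>1 ` (U \<inter> {x \<in> topspace X. \<sigma> x = w}))"
    have "openin Z (\<alpha> w ` \<theta>1 ` (U \<inter> {x \<in> topspace X. \<sigma> x = w}))" for w
    proof -
      have "openin X (U \<inter> {x \<in> topspace X. \<sigma> x = w})"
        by (intro openin_Int U openin_locally_const[OF \<sigma>, of "\<lambda>t. t = w"])
      from T1.openin_inj_image[OF this] show ?thesis
        using homeomorphic_imp_open_map[OF T1.Z.homeo] unfolding open_map_def by blast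
    qed
    then have "openin Z W" unfolding W_def by blast
    from openin_continuous_map_preimage[OF T2.inj_continuous this]
    have "openin Y {y \<in> topspace Y. \<theta>2 y \<in> W}" .
    moreover have "{y \<in> topspace Y. \<theta>2 y \<in> W} = \<theta> ` U"
    proof (intro subset_antisym subsetI)
      fix y assume y: "y \<in> {y \<in> topspace Y. \<theta>2 y \<in> W}"
      then obtain x where x: "x \<in> U" "x \<in> topspace X" "\<theta>2 y = \<alpha> (\<sigma> x) (\<theta>1 x)"
        by (auto simp: W_def)
      then have "\<theta>2 y = \<theta>2 (\<theta> x)" by (simp add: \<theta>(2))
      then show "y \<in> \<theta> ` U" using y x(1) \<theta>(1)[OF x(2)] by simp
    next
      fix y assume "y \<in> \<theta> ` U"
      then obtain x where x: "x \<in> U" "y = \<theta> x" by blast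
      then have xt: "x \<in> topspace X" using Ut by blast
      then show "y \<in> {y \<in> topspace Y. \<theta>2 y \<in> W}" using x \<theta> by (auto simp: W_def)
    qed
    ultimately show "openin Y (\<theta> ` U)" by simp
  qed
  have injm: "inj_on \<theta> (topspace X)"
  proof (rule inj_onI)
    fix x y assume x: "x \<in> topspace X" and y: "y \<in> topspace X" and eq: "\<theta> x = \<theta> y"
    show "x = y" by (rule inj[OF x y]) (simp add: \<theta>(2)[symmetric] x y eq)
  qed
  have orbit: "(\<exists>w. \<phi> w x = y) \<longleftrightarrow> (\<exists>v. \<psi> v (\<theta> x) = \<theta> y)"
    if x: "x \<in> topspace X" and y: "y \<in> topspace X" for x y
  proof -
    \<comment> \<open>The endpoints are displaced by \<open>\<sigma> x\<close> and
      \<open>\<sigma> y\<close>, which turns the connecting vector \<open>v\<close> into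
      \<open>\<sigma> y + v - \<sigma> x\<close>.\<close>
    have "\<alpha> v (\<theta>1 x) = \<theta>1 y \<longleftrightarrow> \<alpha> (\<sigma> y + v - \<sigma> x) (\<theta>2 (\<theta> x)) = \<theta>2 (\<theta> y)" for v
    proof -
      have "\<alpha> (\<sigma> y + v - \<sigma> x) (\<theta>2 (\<theta> x)) = \<alpha> (\<sigma> y) (\<alpha> v (\<theta>1 x))"
        using x by (simp add: \<theta>(2) T1.Z.act_add)
      moreover have "\<theta>2 (\<theta> y) = \<alpha> (\<sigma> y) (\<theta>1 y)" by (rule \<theta>(2)[OF y])
      ultimately show ?thesis
        using x y inj_on_eq_iff[OF homeomorphic_imp_injective_map[OF T1.Z.homeo]] by simp
    qed
    then have "(\<exists>v. \<alpha> v (\<theta>1 x) = \<theta>1 y) \<longleftrightarrow> (\<exists>v. \<alpha> (\<sigma> y + v - \<sigma> x) (\<theta>2 (\<theta> x)) = \<theta>2 (\<theta> y))" by simp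
    also have "\<dots> \<longleftrightarrow> (\<exists>v. \<alpha> v (\<theta>2 (\<theta> x)) = \<theta>2 (\<theta> y))"
    proof
      assume "\<exists>v. \<alpha> v (\<theta>2 (\<theta> x)) = \<theta>2 (\<theta> y)"
      then obtain v where "\<alpha> v (\<theta>2 (\<theta> x)) = \<theta>2 (\<theta> y)" ..
      then have "\<alpha> (\<sigma> y + (v + \<sigma> x - \<sigma> y) - \<sigma> x) (\<theta>2 (\<theta> x)) = \<theta>2 (\<theta> y)" by simp
      then show "\<exists>v. \<alpha> (\<sigma> y + v - \<sigma> x) (\<theta>2 (\<theta> x)) = \<theta>2 (\<theta> y)" ..
    qed blast
    finally show ?thesis
      using T1.orbit_iff[OF x y] T2.orbit_iff[OF \<theta>(1)[OF x] \<theta>(1)[OF y]] by simp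
  qed
  have coc: "cocycle \<phi> \<psi> \<theta> x w = v"
    if x: "x \<in> topspace X" and v: "\<psi> v (\<theta> x) = \<theta> (\<phi> w x)" for x w v
    unfolding cocycle_def
  proof (rule the_equality)
    show "u = v" if "\<psi> u (\<theta> x) = \<theta> (\<phi> w x)" for u
      using that v T2.X.act_eq_iff[OF \<theta>(1)[OF x], of u v] by simp
  qed (rule v)
  have bounded: "locally_const X (\<lambda>x. cocycle \<phi> \<psi> \<theta> x w)" for w
    unfolding locally_const_iff
  proof
    fix x assume x: "x \<in> topspace X"
    obtain v where v: "\<psi> v (\<theta> x) = \<theta> (\<phi> w x)"
      using orbit[OF x T1.X.act_in[OF x], of w] by blast
    \<comment> \<open>With \<open>v\<close> fixed as the cocycle value at \<open>x\<close>, these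
      four locally constant quantities decide whether \<open>v\<close> is also the value at
      \<open>y\<close>; \<open>key\<close> states the test.\<close>
    define e where "e y = ((T1.\<eta> y w, T2.\<eta> (\<theta> y) v), (\<sigma> y, \<sigma> (\<phi> w y)))" for y
    have "locally_const X (\<lambda>y. T2.\<eta> (\<theta> y) v)"
      using continuous_map_compose[OF cont T2.cocycle_locally_const] by (simp add: o_def)
    then have l1: "locally_const X (\<lambda>y. (T1.\<eta> y w, T2.\<eta> (\<theta> y) v))"
      by (rule locally_const_dep2[OF T1.cocycle_locally_const[of w]]) simp
    have l2: "locally_const X (\<lambda>y. (\<sigma> y, \<sigma> (\<phi> w y)))"
      by (rule locally_const_dep2[OF \<sigma> T1.X.locally_const_act[OF \<sigma>, of w]]) simp
    have "locally_const X e"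
      by (rule locally_const_dep2[OF l1 l2]) (simp add: e_def)
    from bspec[OF this[unfolded locally_const_iff] x]
    obtain U where U: "openin X U" "x \<in> U" "\<forall>y\<in>U. e x = e y" by (elim exE conjE)
    have key: "\<psi> v (\<theta> y) = \<theta> (\<phi> w y) \<longleftrightarrow>
        T2.\<eta> (\<theta> y) v + \<sigma> y = \<sigma> (\<phi> w y) + T1.\<eta> y w" if y: "y \<in> topspace X" for y
    proof -
      have "\<theta>2 (\<psi> v (\<theta> y)) = \<alpha> (T2.\<eta> (\<theta> y) v + \<sigma> y) (\<theta>1 y)"
        using y by (simp add: T2.cocycle_eq[symmetric] \<theta> T1.Z.act_add)
      moreover have "\<theta>2 (\<theta> (\<phi> w y)) = \<alpha> (\<sigma> (\<phi> w y) + T1.\<eta> y w) (\<theta>1 y)"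
        using y by (simp add: T1.cocycle_eq[symmetric] \<theta> T1.Z.act_add)
      moreover have "\<psi> v (\<theta> y) = \<theta> (\<phi> w y) \<longleftrightarrow> \<theta>2 (\<psi> v (\<theta> y)) = \<theta>2 (\<theta> (\<phi> w y))"
        using y \<theta>(1) by simp
      ultimately show ?thesis using T1.Z.act_eq_iff[OF T1.inj_in[OF y]] by simp
    qed
    have "cocycle \<phi> \<psi> \<theta> x w = cocycle \<phi> \<psi> \<theta> y w" if y: "y \<in> U" for y
    proof -
      have yt: "y \<in> topspace X" using openin_subset[OF U(1)] y by blast
      have "e x = e y" by (rule bspec[OF U(3) y])
      then have "T2.\<eta> (\<theta> y) v + \<sigma> y = \<sigma> (\<phi> w y) + T1.\<eta> y w"
        using key[OF x] v by (simp add: e_def)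
      then have "\<psi> v (\<theta> y) = \<theta> (\<phi> w y)" using key[OF yt] by simp
      then show ?thesis using coc[OF yt] coc[OF x v] by simp
    qed
    then show "\<exists>U. openin X U \<and> x \<in> U \<and> (\<forall>y\<in>U. cocycle \<phi> \<psi> \<theta> x w = cocycle \<phi> \<psi> \<theta> y w)"
      using U(1,2) by blast
  qed
  show ?thesis
    unfolding bounded_orbit_injection_def orbit_injection_def continuous_map_discrete_prod_iff
    using cont openm injm orbit bounded by blast
qed

theorem theorem3p13:
  fixes X :: "'a topology" and \<phi> :: "int ^ 'd \<Rightarrow> 'a \<Rightarrow> 'a"
    and Y :: "'b topology" and \<psi> :: "int ^ 'd \<Rightarrow> 'b \<Rightarrow> 'b"
    and Z :: "'c topology" and \<alpha> :: "int ^ 'd \<Rightarrow> 'c \<Rightarrow> 'c"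
    and \<theta>1 :: "'a \<Rightarrow> 'c" and \<theta>2 :: "'b \<Rightarrow> 'c"
  assumes "free_minimal_cantor_system X \<phi>"
    and "free_minimal_cantor_system Y \<psi>"
    and "free_minimal_cantor_system Z \<alpha>"
    and "bounded_orbit_injection X \<phi> Z \<alpha> \<theta>1"
    and "bounded_orbit_injection Y \<psi> Z \<alpha> \<theta>2"
    and "GZ_less Z \<alpha>
           (induced_hom X \<phi> Z \<alpha> \<theta>1 (cls X \<phi> (ind X (topspace X))))
           (induced_hom Y \<psi> Z \<alpha> \<theta>2 (cls Y \<psi> (ind Y (topspace Y))))"
  shows "\<exists>\<theta>. bounded_orbit_injection X \<phi> Y \<psi> \<theta>"
proof -
  interpret T1: bounded_injection X \<phi> Z \<alpha> \<theta>1
    by (intro bounded_injection.intro fmc_system.intro bounded_injection_axioms.intro assms)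
  interpret T2: bounded_injection Y \<psi> Z \<alpha> \<theta>2
    by (intro bounded_injection.intro fmc_system.intro bounded_injection_axioms.intro assms)
  define A where "A = \<theta>1 ` topspace X"
  define B where "B = \<theta>2 ` topspace Y"
  have topX: "clopenin X (topspace X)" and topY: "clopenin Y (topspace Y)"
    by (simp_all add: clopenin_def)
  have "clopenin Z A" "clopenin Z B"
    unfolding A_def B_def by (rule T1.clopenin_inj_image[OF topX], rule T2.clopenin_inj_image[OF topY])
  from T1.Z.comparison[OF this] obtain n \<delta> where
    \<delta>: "T1.Z.dmatching A B n \<delta>" "\<forall>z\<in>A. \<delta> z \<noteq> None"
    using assms(6) unfolding T1.induced_hom_ind[OF topX] T2.induced_hom_ind[OF topY]
    by (auto simp: A_def B_def)
  define \<sigma> where "\<sigma> x = the (\<delta> (\<theta>1 x))" for x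
  have \<delta>\<sigma>: "\<delta> (\<theta>1 x) = Some (\<sigma> x)" if "x \<in> topspace X" for x
    using \<delta>(2) that by (auto simp: \<sigma>_def A_def)
  have mem: "\<alpha> (\<sigma> x) (\<theta>1 x) \<in> \<theta>2 ` topspace Y" if x: "x \<in> topspace X" for x
    using T1.Z.dmatchingD(2)[OF \<delta>(1) T1.inj_in[OF x] \<delta>\<sigma>[OF x]] by (simp add: B_def)
  \<comment> \<open>The matching moves \<open>\<theta>1 x\<close> into the image of
    \<open>\<theta>2\<close>, where \<open>\<theta>2\<close> can be inverted.\<close>
  define \<theta> where "\<theta> x = inv_into (topspace Y) \<theta>2 (\<alpha> (\<sigma> x) (\<theta>1 x))" for x
  have "bounded_orbit_injection X \<phi> Y \<psi> \<theta>"
  proof (rule bounded_orbit_injection_lift)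
    show "bounded_injection X \<phi> Z \<alpha> \<theta>1" by (rule T1.bounded_injection_axioms)
    show "bounded_injection Y \<psi> Z \<alpha> \<theta>2" by (rule T2.bounded_injection_axioms)
    have "locally_const X (\<lambda>x. \<delta> (\<theta>1 x))"
      using continuous_map_compose[OF T1.inj_continuous T1.Z.dmatchingD(1)[OF \<delta>(1)]]
      by (simp add: o_def)
    then show "locally_const X \<sigma>" by (rule locally_const_dep) (simp add: \<sigma>_def)
    show "\<theta> x \<in> topspace Y" "\<theta>2 (\<theta> x) = \<alpha> (\<sigma> x) (\<theta>1 x)" if "x \<in> topspace X" for x
      using mem[OF that] unfolding \<theta>_def by (rule inv_into_into, rule f_inv_into_f)
    fix x y assume x: "x \<in> topspace X" and y: "y \<in> topspace X"
      and eq: "\<alpha> (\<sigma> x) (\<theta>1 x) = \<alpha> (\<sigma> y) (\<theta>1 y)"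
    \<comment> \<open>Equal partners put \<open>\<theta>1 x\<close> and \<open>\<theta>1 y\<close>
      on one orbit with connecting vector \<open>\<sigma> x - \<sigma> y\<close>; injectivity of the
      matching forces it to be 0.\<close>
    have "\<alpha> (\<sigma> x - \<sigma> y) (\<theta>1 x) = \<alpha> (- \<sigma> y) (\<alpha> (\<sigma> x) (\<theta>1 x))"
      using x by (simp add: T1.Z.act_add)
    also have "\<dots> = \<theta>1 y" unfolding eq using y by (simp add: T1.Z.act_add)
    finally have *: "\<alpha> (\<sigma> x - \<sigma> y) (\<theta>1 x) = \<theta>1 y" .
    have "\<sigma> x - \<sigma> y = 0"
      by (rule T1.Z.dmatchingD(3)[OF \<delta>(1) T1.inj_in[OF x] \<delta>\<sigma>[OF x], of _ "\<sigma> y"])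
         (simp_all add: * \<delta>\<sigma>[OF y])
    then show "x = y" using * x y by simp
  qed
  then show ?thesis by blast
qed

end
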